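(* Let $R$ be a ring and $M$ a non-zero right $R$-module. If the left $R$-module $M^+=\mathrm{Hom}_{\mathbb{Z}}(M,\mathbb{Q}/\mathbb{Z})$ is Baer, then $\mathrm{Tr}(M,X)$ is a pure submodule of $M$ for every submodule $X\leq M$. If, further, $M$ is flat, then $M/N$ is a flat $R$-module for every submodule $N\leq M$ with $N\in\mathrm{Gen}(M)$.
   Context: Rings have a unit element and modules are unitary. A (left or right) module $L$ is Baer if for every non-empty subset $X$ of its endomorphism ring the submodule $\bigcap_{f\in X}\ker f$ is a direct summand of $L$. $\mathrm{Tr}(M,X)=\sum\{f(M): f\in\mathrm{Hom}_R(M,X)\}$. $\mathrm{Gen}(M)$ is the class of $R$-modules generated by $M$ (homomorphic images of direct sums of copies of $M$). A submodule $N$ of a right $R$-module $M$ is pure if for every left $R$-module $A$ the map $i\otimes 1_A: N\otimes_R A\rightarrow M\otimes_R A$ is injective, where $i:N\rightarrow M$ is the inclusion. *)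

theory Defs
  imports Complex_Main "HOL-Algebra.AbelCoset" "HOL-Algebra.Module"
    "HOL-Algebra.Generated_Groups" "HOL-Algebra.Free_Abelian_Groups"
begin

section \<open>Modules over a not necessarily commutative ring\<close>

text \<open>
  The record \<open>module\<close> of HOL-Algebra serves both as a left and as a right module; its ring
  multiplication and unit are ignored. For a right module, \<open>r \<odot>\<^bsub>M\<^esub> x\<close> stands for
  the product of \<open>x\<close> by \<open>r\<close> from the right, whence the order of the factors in
  \<open>smult_assoc\<close>. The library's \<open>submodule N R M\<close> and the notions below that refer to one
  side only through \<open>\<odot>\<close> apply to both kinds. A submodule \<open>N\<close> is regarded as the module
  \<open>M\<lparr>carrier := N\<rparr>\<close>.
\<close>

locale left_module = R?: ring R + M?: abelian_group M
  for R :: "('r, 'k) ring_scheme" (structure) and M :: "('r, 'a, 'm) module_scheme" (structure) +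
  assumes smult_closed: "\<lbrakk>r \<in> carrier R; x \<in> carrier M\<rbrakk> \<Longrightarrow> r \<odot>\<^bsub>M\<^esub> x \<in> carrier M"
    and smult_l_distr: "\<lbrakk>r \<in> carrier R; s \<in> carrier R; x \<in> carrier M\<rbrakk>
      \<Longrightarrow> (r \<oplus> s) \<odot>\<^bsub>M\<^esub> x = r \<odot>\<^bsub>M\<^esub> x \<oplus>\<^bsub>M\<^esub> s \<odot>\<^bsub>M\<^esub> x"
    and smult_r_distr: "\<lbrakk>r \<in> carrier R; x \<in> carrier M; y \<in> carrier M\<rbrakk>
      \<Longrightarrow> r \<odot>\<^bsub>M\<^esub> (x \<oplus>\<^bsub>M\<^esub> y) = r \<odot>\<^bsub>M\<^esub> x \<oplus>\<^bsub>M\<^esub> r \<odot>\<^bsub>M\<^esub> y"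
    and smult_assoc: "\<lbrakk>r \<in> carrier R; s \<in> carrier R; x \<in> carrier M\<rbrakk>
      \<Longrightarrow> (r \<otimes> s) \<odot>\<^bsub>M\<^esub> x = r \<odot>\<^bsub>M\<^esub> (s \<odot>\<^bsub>M\<^esub> x)"
    and smult_one: "x \<in> carrier M \<Longrightarrow> \<one> \<odot>\<^bsub>M\<^esub> x = x"

locale right_module = R?: ring R + M?: abelian_group M
  for R :: "('r, 'k) ring_scheme" (structure) and M :: "('r, 'a, 'm) module_scheme" (structure) +
  assumes smult_closed: "\<lbrakk>r \<in> carrier R; x \<in> carrier M\<rbrakk> \<Longrightarrow> r \<odot>\<^bsub>M\<^esub> x \<in> carrier M"
    and smult_l_distr: "\<lbrakk>r \<in> carrier R; s \<in> carrier R; x \<in> carrier M\<rbrakk>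
      \<Longrightarrow> (r \<oplus> s) \<odot>\<^bsub>M\<^esub> x = r \<odot>\<^bsub>M\<^esub> x \<oplus>\<^bsub>M\<^esub> s \<odot>\<^bsub>M\<^esub> x"
    and smult_r_distr: "\<lbrakk>r \<in> carrier R; x \<in> carrier M; y \<in> carrier M\<rbrakk>
      \<Longrightarrow> r \<odot>\<^bsub>M\<^esub> (x \<oplus>\<^bsub>M\<^esub> y) = r \<odot>\<^bsub>M\<^esub> x \<oplus>\<^bsub>M\<^esub> r \<odot>\<^bsub>M\<^esub> y"
    and smult_assoc: "\<lbrakk>r \<in> carrier R; s \<in> carrier R; x \<in> carrier M\<rbrakk>
      \<Longrightarrow> (r \<otimes> s) \<odot>\<^bsub>M\<^esub> x = s \<odot>\<^bsub>M\<^esub> (r \<odot>\<^bsub>M\<^esub> x)"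
    and smult_one: "x \<in> carrier M \<Longrightarrow> \<one> \<odot>\<^bsub>M\<^esub> x = x"

text \<open>As for \<open>hom\<close> in the library, values outside the carrier are not constrained.\<close>

definition module_hom ::
  "('r, 'k) ring_scheme \<Rightarrow> ('r, 'a, 'm) module_scheme \<Rightarrow> ('r, 'b, 'n) module_scheme \<Rightarrow> ('a \<Rightarrow> 'b) set"
  where "module_hom R M N = {f \<in> hom (add_monoid M) (add_monoid N).
    \<forall>r \<in> carrier R. \<forall>x \<in> carrier M. f (r \<odot>\<^bsub>M\<^esub> x) = r \<odot>\<^bsub>N\<^esub> f x}"

definition direct_summand ::
  "('r, 'k) ring_scheme \<Rightarrow> ('r, 'a, 'm) module_scheme \<Rightarrow> 'a set \<Rightarrow> bool"
  where "direct_summand R L N \<longleftrightarrow> submodule N R L \<and>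
    (\<exists>K. submodule K R L \<and> N <+>\<^bsub>L\<^esub> K = carrier L \<and> N \<inter> K = {\<zero>\<^bsub>L\<^esub>})"

definition Baer_module :: "('r, 'k) ring_scheme \<Rightarrow> ('r, 'a, 'm) module_scheme \<Rightarrow> bool"
  where "Baer_module R L \<longleftrightarrow>
    (\<forall>S. S \<noteq> {} \<and> S \<subseteq> module_hom R L L \<longrightarrow> direct_summand R L (\<Inter>f \<in> S. a_kernel L L f))"

definition quotient_module ::
  "('r, 'k) ring_scheme \<Rightarrow> ('r, 'a, 'm) module_scheme \<Rightarrow> 'a set \<Rightarrow> ('r, 'a set) module"
  where "quotient_module R M N =
    \<lparr>carrier = a_rcosets\<^bsub>M\<^esub> N,
     monoid.mult = undefined, monoid.one = undefined,
     ring.zero = N, ring.add = set_add M,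
     smult = (\<lambda>r C. N <+>\<^bsub>M\<^esub> ((\<odot>\<^bsub>M\<^esub>) r ` C))\<rparr>"

definition direct_sum_copies :: "'i set \<Rightarrow> ('r, 'a, 'm) module_scheme \<Rightarrow> ('r, 'i \<Rightarrow> 'a) module"
  where "direct_sum_copies I M =
    \<lparr>carrier = {x \<in> I \<rightarrow>\<^sub>E carrier M. finite {i \<in> I. x i \<noteq> \<zero>\<^bsub>M\<^esub>}},
     monoid.mult = undefined, monoid.one = undefined,
     ring.zero = (\<lambda>i \<in> I. \<zero>\<^bsub>M\<^esub>),
     ring.add = (\<lambda>x y. \<lambda>i \<in> I. x i \<oplus>\<^bsub>M\<^esub> y i),
     smult = (\<lambda>r x. \<lambda>i \<in> I. r \<odot>\<^bsub>M\<^esub> x i)\<rparr>"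

text \<open>
  \<open>Gen TYPE('i) R M N\<close>: \<open>N\<close> is a homomorphic image of a direct sum of copies of \<open>M\<close> with
  index set in \<open>'i\<close>. The class Gen(M) is the union of these over all types \<open>'i\<close>.
\<close>

definition Gen ::
  "'i itself \<Rightarrow> ('r, 'k) ring_scheme \<Rightarrow> ('r, 'a, 'm) module_scheme \<Rightarrow> ('r, 'b, 'n) module_scheme \<Rightarrow> bool"
  where "Gen T R M N \<longleftrightarrow>
    (\<exists>(I :: 'i set) h. h \<in> module_hom R (direct_sum_copies I M) N \<and>
      h ` carrier (direct_sum_copies I M) = carrier N)"

text \<open>The sum of a family of submodules is the additive subgroup generated by their union.\<close>

definition module_trace ::
  "('r, 'k) ring_scheme \<Rightarrow> ('r, 'a, 'm) module_scheme \<Rightarrow> ('r, 'b, 'n) module_scheme \<Rightarrow> 'b set"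
  where "module_trace R M Y = generate (add_monoid Y) (\<Union>f \<in> module_hom R M Y. f ` carrier M)"


section \<open>The character module\<close>

definition rat_mod_int :: "rat set monoid"
  where "rat_mod_int = \<lparr>carrier = UNIV, monoid.mult = (+), monoid.one = 0\<rparr> Mod \<int>"

text \<open>
  For a right module \<open>M\<close>, the left module \<open>Hom(M, Q/Z)\<close>, with \<open>(r f)(x) = f (x r)\<close>. Its
  elements are extensional, so that equality in the carrier is equality as functions on \<open>M\<close>.
\<close>

definition character_module :: "('r, 'a, 'm) module_scheme \<Rightarrow> ('r, 'a \<Rightarrow> rat set) module"
  where "character_module M =
    \<lparr>carrier = hom (add_monoid M) rat_mod_int \<inter> extensional (carrier M),
     monoid.mult = undefined, monoid.one = undefined,
     ring.zero = (\<lambda>x \<in> carrier M. \<one>\<^bsub>rat_mod_int\<^esub>),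
     ring.add = (\<lambda>f g. \<lambda>x \<in> carrier M. f x \<otimes>\<^bsub>rat_mod_int\<^esub> g x),
     smult = (\<lambda>r f. \<lambda>x \<in> carrier M. f (r \<odot>\<^bsub>M\<^esub> x))\<rparr>"


section \<open>Tensor products, purity and flatness\<close>

definition tensor_relations ::
  "('r, 'k) ring_scheme \<Rightarrow> ('r, 'a, 'm) module_scheme \<Rightarrow> ('r, 'b, 'n) module_scheme
    \<Rightarrow> (('a \<times> 'b) \<Rightarrow>\<^sub>0 int) set"
  where "tensor_relations R M A =
    {frag_of (x \<oplus>\<^bsub>M\<^esub> y, a) - frag_of (x, a) - frag_of (y, a) | x y a.
       x \<in> carrier M \<and> y \<in> carrier M \<and> a \<in> carrier A} \<union>
    {frag_of (x, a \<oplus>\<^bsub>A\<^esub> b) - frag_of (x, a) - frag_of (x, b) | x a b.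
       x \<in> carrier M \<and> a \<in> carrier A \<and> b \<in> carrier A} \<union>
    {frag_of (r \<odot>\<^bsub>M\<^esub> x, a) - frag_of (x, r \<odot>\<^bsub>A\<^esub> a) | r x a.
       r \<in> carrier R \<and> x \<in> carrier M \<and> a \<in> carrier A}"

definition tensor_subgroup ::
  "('r, 'k) ring_scheme \<Rightarrow> ('r, 'a, 'm) module_scheme \<Rightarrow> ('r, 'b, 'n) module_scheme
    \<Rightarrow> (('a \<times> 'b) \<Rightarrow>\<^sub>0 int) set"
  where "tensor_subgroup R M A =
    generate (free_Abelian_group (carrier M \<times> carrier A)) (tensor_relations R M A)"

text \<open>The tensor product over \<open>R\<close> of a right module \<open>M\<close> and a left module \<open>A\<close>.\<close>

definition tensor_product ::
  "('r, 'k) ring_scheme \<Rightarrow> ('r, 'a, 'm) module_scheme \<Rightarrow> ('r, 'b, 'n) module_scheme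
    \<Rightarrow> (('a \<times> 'b) \<Rightarrow>\<^sub>0 int) set monoid"
  where "tensor_product R M A =
    free_Abelian_group (carrier M \<times> carrier A) Mod tensor_subgroup R M A"

text \<open>
  The map \<open>f \<otimes> g\<close> into the tensor product of \<open>M'\<close> and \<open>A'\<close>: a coset is sent to the coset of
  the images of its elements under the linear extension of \<open>(x, a) \<mapsto> (f x, g a)\<close>.
\<close>

definition tensor_map ::
  "('r, 'k) ring_scheme \<Rightarrow> ('r, 'c, 'm) module_scheme \<Rightarrow> ('r, 'd, 'n) module_scheme
    \<Rightarrow> ('a \<Rightarrow> 'c) \<Rightarrow> ('b \<Rightarrow> 'd) \<Rightarrow> (('a \<times> 'b) \<Rightarrow>\<^sub>0 int) set \<Rightarrow> (('c \<times> 'd) \<Rightarrow>\<^sub>0 int) set"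
  where "tensor_map R M' A' f g C =
    tensor_subgroup R M' A' <#>\<^bsub>free_Abelian_group (carrier M' \<times> carrier A')\<^esub>
      (frag_extend (\<lambda>(x, a). frag_of (f x, g a)) ` C)"

text \<open>
  HOL cannot quantify over types inside a formula, so the left modules in the next two
  definitions range over those with carrier in a type \<open>'u\<close>, passed as an argument. Purity and
  flatness proper mean that the predicate holds for all types \<open>'u\<close>.
\<close>

definition pure_submodule ::
  "'u itself \<Rightarrow> ('r, 'k) ring_scheme \<Rightarrow> ('r, 'a, 'm) module_scheme \<Rightarrow> 'a set \<Rightarrow> bool"
  where "pure_submodule T R M N \<longleftrightarrow> submodule N R M \<and>
    (\<forall>A :: ('r, 'u) module. left_module R A \<longrightarrow>
      inj_on (tensor_map R M A (\<lambda>x. x) (\<lambda>a. a))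
        (carrier (tensor_product R (M\<lparr>carrier := N\<rparr>) A)))"

definition flat_module ::
  "'u itself \<Rightarrow> ('r, 'k) ring_scheme \<Rightarrow> ('r, 'a, 'm) module_scheme \<Rightarrow> bool"
  where "flat_module T R M \<longleftrightarrow> right_module R M \<and>
    (\<forall>(A :: ('r, 'u) module) (B :: ('r, 'u) module) g.
      left_module R A \<and> left_module R B \<and> g \<in> module_hom R A B \<and> inj_on g (carrier A) \<longrightarrow>
      inj_on (tensor_map R M B (\<lambda>x. x) g) (carrier (tensor_product R M A)))"

end

theory Submission
  imports Defs "HOL-Algebra.Multiplicative_Group"
begin

text \<open>
  For \<open>T = Tr(M, Y)\<close>, the annihilator of \<open>T\<close> in the character module of \<open>M\<close> is the intersection of
  the kernels of the endomorphisms \<open>\<phi> \<mapsto> \<phi> \<circ> f\<close>, where \<open>f\<close> ranges over the homomorphisms from \<open>M\<close>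
  to \<open>Y\<close>; by the Baer property it is a direct summand. Since \<open>Q/Z\<close> is an injective cogenerator, a
  map of tensor products is injective iff every character of its domain, seen as a balanced map,
  extends to its codomain. Combining an arbitrary extension of characters with a projection along
  the direct sum makes the extension \<open>R\<close>-linear. This gives the purity of \<open>T\<close> in \<open>M\<close>, and it gives
  the flatness of \<open>M/T\<close> if \<open>M\<close> is flat. A submodule generated by \<open>M\<close> is its own trace.
\<close>

section \<open>Divisible groups are injective\<close>

text \<open>Currying turns a balanced map on \<open>M\<close> and \<open>A\<close> into an
  \<open>R\<close>-linear map from \<open>A\<close> to the characters of \<open>M\<close>. In this
  language purity of \<open>T\<close> asks that linear maps from \<open>A\<close> to the characters
  of \<open>T\<close> lift along restriction of characters, whose kernel is the annihilator of
  \<open>T\<close>. Injectivity of \<open>Q/Z\<close> lifts each value separately, and the lifts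
  need not fit together linearly. Two lifts of one character differ by an element of the
  annihilator, so the projection onto a complement removes the ambiguity and restores linearity.
  Flatness of \<open>M\<close> says that linear maps into its characters extend along injections.
  The annihilator of \<open>T\<close>, as the characters of \<open>M/T\<close>, inherits this from
  \<open>M\<close> as a direct summand. Purity thus uses the projection with kernel the annihilator,
  flatness the one with image the annihilator.\<close>

locale divisible_group = comm_group +
  assumes divisible: "\<lbrakk>d \<in> carrier G; 0 < n\<rbrakk> \<Longrightarrow> \<exists>e \<in> carrier G. e [^] (n::nat) = d"

lemma comm_group_DirProd:
  assumes "comm_group G" "comm_group H"
  shows "comm_group (G \<times>\<times> H)"
proof -
  interpret G: comm_group G by fact
  interpret H: comm_group H by fact
  show ?thesis
    by (rule group.group_comm_groupI [OF DirProd_group])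
      (auto simp: DirProd_def G.is_group H.is_group G.m_comm H.m_comm)
qed

lemma int_pow_DirProd:
  assumes "group G" "group H" "x \<in> carrier G" "y \<in> carrier H"
  shows "(x, y) [^]\<^bsub>G \<times>\<times> H\<^esub> (n::int) = (x [^]\<^bsub>G\<^esub> n, y [^]\<^bsub>H\<^esub> n)"
proof -
  have "fst \<in> hom (G \<times>\<times> H) G" "snd \<in> hom (G \<times>\<times> H) H"
    by (auto simp: hom_def DirProd_def)
  then have "fst ((x, y) [^]\<^bsub>G \<times>\<times> H\<^esub> n) = x [^]\<^bsub>G\<^esub> n" "snd ((x, y) [^]\<^bsub>G \<times>\<times> H\<^esub> n) = y [^]\<^bsub>H\<^esub> n"
    using hom_int_pow[of fst "G \<times>\<times> H" G "(x, y)" n] hom_int_pow[of snd "G \<times>\<times> H" H "(x, y)" n] assms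
    by (auto simp: DirProd_group)
  then show ?thesis by (metis prod.collapse)
qed

text \<open>The number \<open>k\<close> is the order of the coset of \<open>x\<close> in the
  quotient by \<open>S\<close>. Infinite order is encoded as 0, and \<open>0 dvd n\<close> holds
  only for \<open>n = 0\<close>, so both cases have one statement.\<close>

lemma (in comm_group) int_pow_mem_subgroup_iff:
  assumes S: "subgroup S G" and x: "x \<in> carrier G"
  obtains k :: nat where "\<And>n::int. x [^] n \<in> S \<longleftrightarrow> int k dvd n"
proof -
  interpret S: normal S G using S by (simp add: normal_iff_subgroup)
  interpret Q: group "G Mod S" by (rule S.factorgroup_is_group)
  have mem: "S #> x \<in> carrier (G Mod S)" using x by (auto simp: carrier_FactGroup)
  have "x [^] n \<in> S \<longleftrightarrow> int (Q.ord (S #> x)) dvd n" for n :: int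
  proof -
    have "x [^] n \<in> S \<longleftrightarrow> S #> x [^] n = S"
      using x coset_join1[OF _ _ S] coset_join2[OF _ S] by blast
    also have "\<dots> \<longleftrightarrow> int (Q.ord (S #> x)) dvd n"
      using Q.int_pow_eq_id[OF mem, of n] x by (simp add: S.FactGroup_int_pow)
    finally show ?thesis .
  qed
  then show thesis using that by blast
qed

context divisible_group
begin

text \<open>\<open>\<Gamma>\<close> is the graph of a partial homomorphism. The exponents
  \<open>n\<close> for which the power of \<open>x\<close> lies in its domain are the multiples of
  some \<open>k\<close>; a \<open>k\<close>-th root of the value at exponent \<open>k\<close> is
  then compatible with all prescribed values. This is the only place where divisibility enters the
  extension argument.\<close>

lemma partial_hom_value:
  assumes D: "comm_group D" and \<Gamma>: "subgroup \<Gamma> (D \<times>\<times> G)"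
    and sv: "\<And>d. (\<one>\<^bsub>D\<^esub>, d) \<in> \<Gamma> \<Longrightarrow> d = \<one>" and x: "x \<in> carrier D"
  shows "\<exists>d \<in> carrier G. \<forall>(n::int) y. (x [^]\<^bsub>D\<^esub> n, y) \<in> \<Gamma> \<longrightarrow> y = d [^] n"
proof -
  interpret D: comm_group D by fact
  interpret DG: group "D \<times>\<times> G" by (simp add: DirProd_group)
  interpret \<Gamma>: subgroup \<Gamma> "D \<times>\<times> G" by fact
  have carr: "a \<in> carrier D" "b \<in> carrier G" if "(a, b) \<in> \<Gamma>" for a b
    using \<Gamma>.mem_carrier[OF that] by auto
  have uniq: "b = b'" if "(a, b) \<in> \<Gamma>" "(a, b') \<in> \<Gamma>" for a b b'
    using sv[of "b \<otimes> inv b'"] \<Gamma>.m_closed[OF that(1) \<Gamma>.m_inv_closed[OF that(2)]]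
      carr[OF that(1)] carr[OF that(2)]
    by (simp add: inv_solve_right')
  have "group_hom (D \<times>\<times> G) D fst"
    by unfold_locales (auto simp: hom_def)
  then obtain k :: nat where k: "\<And>n::int. x [^]\<^bsub>D\<^esub> n \<in> fst ` \<Gamma> \<longleftrightarrow> int k dvd n"
    using D.int_pow_mem_subgroup_iff x \<Gamma> group_hom.subgroup_img_is_subgroup by metis
  then obtain y0 where y0: "(x [^]\<^bsub>D\<^esub> int k, y0) \<in> \<Gamma>"
    using k[of "int k"] by (metis dvd_refl imageE prod.collapse)
  obtain d where d: "d \<in> carrier G" "d [^] int k = y0"
  \<comment> \<open>Divisibility gives roots for positive exponents only. For \<open>k = 0\<close>
    the prescribed value sits over the unit, so \<open>sv\<close> makes it the unit.\<close>
  proof (cases "k = 0")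
    case True
    with y0 sv have "y0 = \<one>" by simp
    with True that[of \<one>] show thesis by simp
  next
    case False
    with divisible[OF carr(2)[OF y0], of k] that show thesis by (auto simp: int_pow_int)
  qed
  have "y = d [^] n" if y: "(x [^]\<^bsub>D\<^esub> n, y) \<in> \<Gamma>" for n :: int and y
  proof -
    have "x [^]\<^bsub>D\<^esub> n \<in> fst ` \<Gamma>" using imageI[OF y, of fst] by simp
    then obtain q where n: "n = int k * q" unfolding k by (rule dvdE)
    have "(x [^]\<^bsub>D\<^esub> int k, y0) [^]\<^bsub>D \<times>\<times> G\<^esub> q \<in> \<Gamma>"
      using DG.subgroup_int_pow_closed[OF \<Gamma> y0] .
    then have "(x [^]\<^bsub>D\<^esub> n, d [^] n) \<in> \<Gamma>"
      using x d(1) unfolding d(2)[symmetric] n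
      by (simp add: int_pow_DirProd D.int_pow_pow int_pow_pow)
    with y uniq show ?thesis by simp
  qed
  with d show ?thesis by blast
qed

text \<open>The graph is multiplied by the cyclic subgroup generated by \<open>(x, d)\<close>. The
  value \<open>d\<close> from \<open>partial_hom_value\<close> respects every relation between
  powers of \<open>x\<close> and the old domain, which is what single-valuedness over the unit
  amounts to.\<close>

lemma partial_hom_step:
  assumes D: "comm_group D" and \<Gamma>: "subgroup \<Gamma> (D \<times>\<times> G)"
    and sv: "\<And>d. (\<one>\<^bsub>D\<^esub>, d) \<in> \<Gamma> \<Longrightarrow> d = \<one>" and x: "x \<in> carrier D"
  shows "\<exists>\<Gamma>' d. subgroup \<Gamma>' (D \<times>\<times> G) \<and> (\<forall>d. (\<one>\<^bsub>D\<^esub>, d) \<in> \<Gamma>' \<longrightarrow> d = \<one>) \<and> \<Gamma> \<subseteq> \<Gamma>' \<and> (x, d) \<in> \<Gamma>'"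
proof -
  interpret D: comm_group D by fact
  interpret DG: comm_group "D \<times>\<times> G"
    by (simp add: comm_group_DirProd D comm_group_axioms)
  interpret \<Gamma>: subgroup \<Gamma> "D \<times>\<times> G" by fact
  obtain d where d: "d \<in> carrier G" and dn: "\<And>(n::int) y. (x [^]\<^bsub>D\<^esub> n, y) \<in> \<Gamma> \<Longrightarrow> y = d [^] n"
    using partial_hom_value[OF assms] by blast
  define C where "C = generate (D \<times>\<times> G) {(x, d)}"
  have C: "C = {(x [^]\<^bsub>D\<^esub> n, d [^] n) | n::int. True}"
    unfolding C_def using x d by (subst DG.generate_pow) (auto simp: int_pow_DirProd)
  have sub: "subgroup C (D \<times>\<times> G)"
    unfolding C_def using x d by (auto intro: DG.generate_is_subgroup)
  have "(\<one>\<^bsub>D \<times>\<times> G\<^esub>) \<in> C" using subgroup.one_closed[OF sub] .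
  then have incl: "\<Gamma> \<subseteq> \<Gamma> <#>\<^bsub>D \<times>\<times> G\<^esub> C"
    unfolding set_mult_def using DG.r_one \<Gamma>.mem_carrier by fastforce
  have "(x, d) \<in> C" by (simp add: C_def generate.incl)
  then have "(x, d) \<in> \<Gamma> <#>\<^bsub>D \<times>\<times> G\<^esub> C"
    unfolding set_mult_def using DG.l_one[of "(x, d)"] \<Gamma>.one_closed subgroup.mem_carrier[OF sub] by fastforce
  moreover have "e = \<one>" if e: "(\<one>\<^bsub>D\<^esub>, e) \<in> \<Gamma> <#>\<^bsub>D \<times>\<times> G\<^esub> C" for e
  proof -
    obtain a b and n :: int where ab: "(a, b) \<in> \<Gamma>" and eq: "\<one>\<^bsub>D\<^esub> = a \<otimes>\<^bsub>D\<^esub> x [^]\<^bsub>D\<^esub> n" "e = b \<otimes> d [^] n"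
      using e unfolding set_mult_def C by fastforce
    have carr: "a \<in> carrier D" "b \<in> carrier G" using \<Gamma>.mem_carrier[OF ab] by auto
    \<comment> \<open>A point over the unit puts a power of \<open>x\<close> into the old domain,
      where \<open>dn\<close> fixes its value; that value cancels the contribution of
      \<open>d\<close>.\<close>
    have "a = x [^]\<^bsub>D\<^esub> (- n)"
      using eq(1) carr x by (metis D.inv_equality D.int_pow_closed D.int_pow_neg D.inv_inv)
    then have "b = inv (d [^] n)" using dn[of "- n" b] ab d by (simp add: int_pow_neg)
    then show ?thesis using eq d by simp
  qed
  ultimately show ?thesis
    using DG.mult_subgroups[OF \<Gamma> sub] incl by blast
qed

text \<open>Zorn's lemma is applied to graphs, so that extension is plain inclusion and an upper
  bound of a chain is its union. A maximal graph has full domain by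
  \<open>partial_hom_step\<close>.\<close>

lemma partial_hom_extend:
  assumes D: "comm_group D" and \<Gamma>: "subgroup \<Gamma> (D \<times>\<times> G)"
    and sv: "\<And>d. (\<one>\<^bsub>D\<^esub>, d) \<in> \<Gamma> \<Longrightarrow> d = \<one>"
  obtains \<psi> where "\<psi> \<in> hom D G" "\<And>a b. (a, b) \<in> \<Gamma> \<Longrightarrow> \<psi> a = b"
proof -
  interpret D: comm_group D by fact
  interpret DG: comm_group "D \<times>\<times> G"
    by (simp add: comm_group_DirProd D comm_group_axioms)
  define \<A> where "\<A> = {\<Delta>. subgroup \<Delta> (D \<times>\<times> G) \<and> (\<forall>d. (\<one>\<^bsub>D\<^esub>, d) \<in> \<Delta> \<longrightarrow> d = \<one>) \<and> \<Gamma> \<subseteq> \<Delta>}"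
  have "\<exists>\<Delta>\<in>\<A>. \<forall>X\<in>\<A>. \<Delta> \<subseteq> X \<longrightarrow> X = \<Delta>"
  proof (rule subset_Zorn_nonempty)
    show "\<A> \<noteq> {}" using assms by (auto simp: \<A>_def)
    fix \<C> assume ne: "\<C> \<noteq> {}" and ch: "subset.chain \<A> \<C>"
    have sub: "subgroup X (D \<times>\<times> G)" if "X \<in> \<C>" for X
      using ch that by (auto simp: \<A>_def subset_chain_def)
    have "subgroup (\<Union>\<C>) (D \<times>\<times> G)"
    proof (rule DG.subgroupI)
      show "\<Union>\<C> \<subseteq> carrier (D \<times>\<times> G)" using sub subgroup.subset by blast
      show "\<Union>\<C> \<noteq> {}" using ne sub subgroup.one_closed by blast
      show "inv\<^bsub>D \<times>\<times> G\<^esub> a \<in> \<Union>\<C>" if "a \<in> \<Union>\<C>" for a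
        using that by (auto dest: subgroup.m_inv_closed[OF sub])
      show "a \<otimes>\<^bsub>D \<times>\<times> G\<^esub> b \<in> \<Union>\<C>" if ab: "a \<in> \<Union>\<C>" "b \<in> \<Union>\<C>" for a b
      proof -
        obtain X Y where XY: "X \<in> \<C>" "a \<in> X" "Y \<in> \<C>" "b \<in> Y" using ab by blast
        then have "X \<subseteq> Y \<or> Y \<subseteq> X" using ch by (auto simp: subset_chain_def)
        then show ?thesis
          using XY subgroup.m_closed[OF sub[OF XY(1)], of a b] subgroup.m_closed[OF sub[OF XY(3)], of a b]
          by blast
      qed
    qed
    moreover have "(\<forall>d. (\<one>\<^bsub>D\<^esub>, d) \<in> \<Union>\<C> \<longrightarrow> d = \<one>) \<and> \<Gamma> \<subseteq> \<Union>\<C>"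
      using ch ne by (auto simp: \<A>_def subset_chain_def)
    ultimately show "\<Union>\<C> \<in> \<A>" by (simp add: \<A>_def)
  qed
  then obtain \<Delta> where \<Delta>: "\<Delta> \<in> \<A>" and max: "\<And>X. \<lbrakk>X \<in> \<A>; \<Delta> \<subseteq> X\<rbrakk> \<Longrightarrow> X = \<Delta>" by blast
  then have sub: "subgroup \<Delta> (D \<times>\<times> G)" and sv': "\<And>d. (\<one>\<^bsub>D\<^esub>, d) \<in> \<Delta> \<Longrightarrow> d = \<one>" and incl: "\<Gamma> \<subseteq> \<Delta>"
    by (auto simp: \<A>_def)
  interpret \<Delta>: subgroup \<Delta> "D \<times>\<times> G" by fact
  have tot: "\<exists>d. (x, d) \<in> \<Delta>" if x: "x \<in> carrier D" for x
  proof -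
    obtain X d where X: "subgroup X (D \<times>\<times> G)" "\<forall>d. (\<one>\<^bsub>D\<^esub>, d) \<in> X \<longrightarrow> d = \<one>" "\<Delta> \<subseteq> X" "(x, d) \<in> X"
      using partial_hom_step[OF D sub sv' x] by blast
    then have "X \<in> \<A>" using incl by (auto simp: \<A>_def)
    then show ?thesis using max X by blast
  qed
  have carr: "a \<in> carrier D" "b \<in> carrier G" if "(a, b) \<in> \<Delta>" for a b
    using \<Delta>.mem_carrier[OF that] by auto
  have uniq: "b = b'" if "(a, b) \<in> \<Delta>" "(a, b') \<in> \<Delta>" for a b b'
    using sv'[of "b \<otimes> inv b'"] \<Delta>.m_closed[OF that(1) \<Delta>.m_inv_closed[OF that(2)]]
      carr[OF that(1)] carr[OF that(2)]
    by (simp add: inv_solve_right')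
  define \<psi> where "\<psi> x = (THE d. (x, d) \<in> \<Delta>)" for x
  have \<psi>: "\<psi> a = b" if "(a, b) \<in> \<Delta>" for a b
    unfolding \<psi>_def using that uniq by (intro the_equality)
  show thesis
  proof
    show "\<psi> \<in> hom D G"
    proof (rule homI)
      show "\<psi> x \<in> carrier G" if "x \<in> carrier D" for x
        using tot[OF that] \<psi> carr by auto
      show "\<psi> (x \<otimes>\<^bsub>D\<^esub> y) = \<psi> x \<otimes> \<psi> y" if xy: "x \<in> carrier D" "y \<in> carrier D" for x y
      proof -
        obtain a b where "(x, a) \<in> \<Delta>" "(y, b) \<in> \<Delta>" using tot xy by blast
        moreover from \<Delta>.m_closed[OF this] have "(x \<otimes>\<^bsub>D\<^esub> y, a \<otimes> b) \<in> \<Delta>" by simp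
        ultimately show ?thesis using \<psi> by simp
      qed
    qed
    show "\<psi> a = b" if "(a, b) \<in> \<Gamma>" for a b using that incl \<psi> by blast
  qed
qed

text \<open>The values are prescribed on the image of \<open>E\<close> and on \<open>T\<close>
  together, and \<open>ker\<close> is the condition for these prescriptions to agree. Keeping
  \<open>T\<close> as a parameter allows extension through a quotient by \<open>T\<close> without
  forming the quotient: \<open>T\<close> will be a subgroup to separate from, the relations of a
  tensor product, or trivial.\<close>

theorem hom_extend:
  assumes D: "comm_group D" and H: "group H" and E: "E \<in> hom H D" and T: "subgroup T D"
    and \<chi>: "\<chi> \<in> hom H G" and ker: "\<And>u. \<lbrakk>u \<in> carrier H; E u \<in> T\<rbrakk> \<Longrightarrow> \<chi> u = \<one>"
  obtains \<psi> where "\<psi> \<in> hom D G" "\<And>t. t \<in> T \<Longrightarrow> \<psi> t = \<one>" "\<And>u. u \<in> carrier H \<Longrightarrow> \<psi> (E u) = \<chi> u"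
proof -
  interpret D: comm_group D by fact
  interpret H: group H by fact
  interpret T: subgroup T D by fact
  interpret E: group_hom H D E using E by unfold_locales
  interpret \<chi>: group_hom H G \<chi> using \<chi> by unfold_locales
  interpret DG: comm_group "D \<times>\<times> G"
    by (simp add: comm_group_DirProd D comm_group_axioms)
  define \<Gamma> where "\<Gamma> = {(E u \<otimes>\<^bsub>D\<^esub> t, \<chi> u) | u t. u \<in> carrier H \<and> t \<in> T}"
  have I: "(E u \<otimes>\<^bsub>D\<^esub> t, \<chi> u) \<in> \<Gamma>" if "u \<in> carrier H" "t \<in> T" for u t
    using that by (auto simp: \<Gamma>_def)
  have "subgroup \<Gamma> (D \<times>\<times> G)"
  proof (rule DG.subgroupI)
    show "\<Gamma> \<subseteq> carrier (D \<times>\<times> G)" by (auto simp: \<Gamma>_def)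
    show "\<Gamma> \<noteq> {}" using I[OF H.one_closed T.one_closed] by blast
    show "inv\<^bsub>D \<times>\<times> G\<^esub> a \<in> \<Gamma>" if "a \<in> \<Gamma>" for a
    proof -
      obtain u t where a: "a = (E u \<otimes>\<^bsub>D\<^esub> t, \<chi> u)" "u \<in> carrier H" "t \<in> T" using \<open>a \<in> \<Gamma>\<close> by (auto simp: \<Gamma>_def)
      then show ?thesis
        using I[of "inv\<^bsub>H\<^esub> u" "inv\<^bsub>D\<^esub> t"] by (simp add: D.inv_mult)
    qed
    show "a \<otimes>\<^bsub>D \<times>\<times> G\<^esub> b \<in> \<Gamma>" if "a \<in> \<Gamma>" "b \<in> \<Gamma>" for a b
    proof -
      obtain u t where a: "a = (E u \<otimes>\<^bsub>D\<^esub> t, \<chi> u)" "u \<in> carrier H" "t \<in> T" using \<open>a \<in> \<Gamma>\<close> by (auto simp: \<Gamma>_def)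
      obtain u' t' where b: "b = (E u' \<otimes>\<^bsub>D\<^esub> t', \<chi> u')" "u' \<in> carrier H" "t' \<in> T" using \<open>b \<in> \<Gamma>\<close> by (auto simp: \<Gamma>_def)
      then show ?thesis
        using a I[of "u \<otimes>\<^bsub>H\<^esub> u'" "t \<otimes>\<^bsub>D\<^esub> t'"] by (simp add: D.m_ac)
    qed
  qed
  moreover have "d = \<one>" if one: "(\<one>\<^bsub>D\<^esub>, d) \<in> \<Gamma>" for d
  proof -
    obtain u t where u: "\<one>\<^bsub>D\<^esub> = E u \<otimes>\<^bsub>D\<^esub> t" "d = \<chi> u" "u \<in> carrier H" "t \<in> T"
      using one by (auto simp: \<Gamma>_def)
    have "E u = inv\<^bsub>D\<^esub> t"
      using u D.inv_equality[of "E u" t] by simp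
    then have "E u \<in> T" using u by simp
    with ker u show ?thesis by simp
  qed
  ultimately obtain \<psi> where \<psi>: "\<psi> \<in> hom D G" "\<And>a b. (a, b) \<in> \<Gamma> \<Longrightarrow> \<psi> a = b"
    using partial_hom_extend[OF D] by blast
  show thesis
  proof
    show "\<psi> \<in> hom D G" by fact
    show "\<psi> t = \<one>" if "t \<in> T" for t using \<psi>(2)[OF I[OF H.one_closed that]] that by simp
    show "\<psi> (E u) = \<chi> u" if "u \<in> carrier H" for u using \<psi>(2)[OF I[OF that T.one_closed]] that by simp
  qed
qed

end

section \<open>The group Q/Z\<close>

definition rat_group :: "rat monoid"
  where "rat_group = \<lparr>carrier = UNIV, monoid.mult = (+), monoid.one = 0\<rparr>"

definition rat_class :: "rat \<Rightarrow> rat set"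
  where "rat_class q = \<int> #>\<^bsub>rat_group\<^esub> q"

lemma rat_group_simps [simp]:
  "carrier rat_group = UNIV" "x \<otimes>\<^bsub>rat_group\<^esub> y = x + y" "\<one>\<^bsub>rat_group\<^esub> = 0"
  by (simp_all add: rat_group_def)

lemma comm_group_rat_group: "comm_group rat_group"
proof (rule comm_groupI)
  show "\<exists>y\<in>carrier rat_group. y \<otimes>\<^bsub>rat_group\<^esub> x = \<one>\<^bsub>rat_group\<^esub>" for x
    by (auto intro: exI[of _ "- x"])
qed auto

lemma rat_mod_int_eq: "rat_mod_int = rat_group Mod \<int>"
  by (simp add: rat_mod_int_def rat_group_def)

lemma subgroup_Ints: "subgroup \<int> rat_group"
proof -
  interpret comm_group rat_group by (rule comm_group_rat_group)
  have "inv\<^bsub>rat_group\<^esub> x = - x" for x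
    by (rule inv_equality) auto
  then show ?thesis by (intro subgroupI) auto
qed

lemma normal_Ints: "\<int> \<lhd> rat_group"
  using comm_group.normal_iff_subgroup[OF comm_group_rat_group] subgroup_Ints by blast

lemma comm_group_rat_mod_int: "comm_group rat_mod_int"
  unfolding rat_mod_int_eq by (rule comm_group.abelian_FactGroup[OF comm_group_rat_group subgroup_Ints])

lemma rat_class_hom: "rat_class \<in> hom rat_group rat_mod_int"
  unfolding rat_mod_int_eq rat_class_def[abs_def] using normal.r_coset_hom_Mod[OF normal_Ints] .

lemma rat_class_closed [simp]: "rat_class q \<in> carrier rat_mod_int"
  using hom_in_carrier[OF rat_class_hom] by simp

lemma rat_class_add: "rat_class (p + q) = rat_class p \<otimes>\<^bsub>rat_mod_int\<^esub> rat_class q"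
  using hom_mult[OF rat_class_hom, of p q] by simp

lemma rat_class_eq_one_iff: "rat_class q = \<one>\<^bsub>rat_mod_int\<^esub> \<longleftrightarrow> q \<in> \<int>"
proof -
  interpret comm_group rat_group by (rule comm_group_rat_group)
  show ?thesis
    using coset_join1[OF _ _ subgroup_Ints, of q] coset_join2[OF _ subgroup_Ints, of q]
    by (auto simp: rat_mod_int_eq rat_class_def)
qed

lemma rat_class_surj: "d \<in> carrier rat_mod_int \<Longrightarrow> \<exists>q. d = rat_class q"
  by (auto simp: rat_mod_int_eq rat_class_def carrier_FactGroup)

interpretation QZ: divisible_group rat_mod_int
proof -
  interpret comm_group rat_mod_int by (rule comm_group_rat_mod_int)
  have pow: "rat_class q [^]\<^bsub>rat_mod_int\<^esub> n = rat_class (of_nat n * q)" for q and n :: nat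
  proof (induction n)
    case 0
    show ?case using rat_class_eq_one_iff[of 0] by simp
  next
    case (Suc n)
    then show ?case by (simp add: rat_class_add[symmetric] algebra_simps)
  qed
  show "divisible_group rat_mod_int"
  proof
    fix d and n :: nat
    assume "d \<in> carrier rat_mod_int" "0 < n"
    then obtain q where "d = rat_class q" using rat_class_surj by blast
    with \<open>0 < n\<close> show "\<exists>e\<in>carrier rat_mod_int. e [^]\<^bsub>rat_mod_int\<^esub> n = d"
      by (intro bexI[of _ "rat_class (q / of_nat n)"]) (simp_all add: pow)
  qed
qed

text \<open>\<open>Q/Z\<close> is a cogenerator: a character of the cyclic group generated by the
  coset of \<open>u\<close> that is nontrivial at this coset is extended by injectivity. The cyclic
  group is parametrized by the integers through the powers of \<open>u\<close>.\<close>

lemma character_separates: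
  assumes G: "comm_group G" and S: "subgroup S G" and u: "u \<in> carrier G" "u \<notin> S"
  obtains \<psi> where "\<psi> \<in> hom G rat_mod_int" "\<And>s. s \<in> S \<Longrightarrow> \<psi> s = \<one>\<^bsub>rat_mod_int\<^esub>"
    "\<psi> u \<noteq> \<one>\<^bsub>rat_mod_int\<^esub>"
proof -
  interpret comm_group G by fact
  obtain k :: nat where k: "\<And>n::int. u [^]\<^bsub>G\<^esub> n \<in> S \<longleftrightarrow> int k dvd n"
    by (rule int_pow_mem_subgroup_iff[OF S u(1)]) blast
  have "k \<noteq> 1" using k[of 1] u by auto
  \<comment> \<open>The value at \<open>u\<close> must be annihilated by \<open>k\<close> and be
    nonzero in \<open>Q/Z\<close>; \<open>1 / k\<close> works since \<open>k\<close> is not 1. For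
    \<open>k = 0\<close> there is no constraint on the order, and \<open>1 / 2\<close> is one
    non-integer.\<close>
  define q :: rat where "q = (if k = 0 then 1 / 2 else 1 / of_nat k)"
  have q: "q \<notin> \<int>"
  proof
    have "0 < q" "q < 1" using \<open>k \<noteq> 1\<close> by (auto simp: q_def)
    moreover assume "q \<in> \<int>"
    ultimately show False by (auto elim!: Ints_cases)
  qed
  have E: "(\<lambda>n::int. u [^]\<^bsub>G\<^esub> n) \<in> hom integer_group G"
    using u by (auto simp: hom_def int_pow_mult)
  have \<chi>: "(\<lambda>n. rat_class (of_int n * q)) \<in> hom integer_group rat_mod_int"
    by (auto simp: hom_def ring_distribs rat_class_add)
  have ker: "rat_class (of_int n * q) = \<one>\<^bsub>rat_mod_int\<^esub>" if n: "u [^]\<^bsub>G\<^esub> n \<in> S" for n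
  proof -
    obtain m where "n = int k * m" using n k by (auto elim: dvdE)
    then show ?thesis by (cases "k = 0") (auto simp: q_def rat_class_eq_one_iff)
  qed
  obtain \<psi> where \<psi>: "\<psi> \<in> hom G rat_mod_int" "\<And>s. s \<in> S \<Longrightarrow> \<psi> s = \<one>\<^bsub>rat_mod_int\<^esub>"
    "\<And>n. \<psi> (u [^]\<^bsub>G\<^esub> (n::int)) = rat_class (of_int n * q)"
    using QZ.hom_extend[OF G group_integer_group E S \<chi> ker] by auto
  have "\<psi> u \<noteq> \<one>\<^bsub>rat_mod_int\<^esub>"
    using \<psi>(3)[of 1] q u by (simp add: rat_class_eq_one_iff)
  with that[OF \<psi>(1,2)] show thesis by blast
qed

section \<open>Characters of tensor products\<close>

text \<open>In the form of \<open>tensor_map\<close>, this is the homomorphism of quotients induced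
  by \<open>E\<close>: by \<open>img\<close> it sends the coset of \<open>u\<close> to the coset of
  \<open>E u\<close>. Its injectivity is triviality of its kernel, expressed by
  representatives.\<close>

lemma FactGroup_map_inj_on_iff:
  assumes G: "comm_group G" and H: "comm_group H" and E: "E \<in> hom G H"
    and S: "subgroup S G" and T: "subgroup T H" and ST: "E ` S \<subseteq> T"
  shows "inj_on (\<lambda>C. T <#>\<^bsub>H\<^esub> (E ` C)) (carrier (G Mod S)) \<longleftrightarrow>
    (\<forall>u \<in> carrier G. E u \<in> T \<longrightarrow> u \<in> S)"
proof -
  interpret G: comm_group G by fact
  interpret H: comm_group H by fact
  interpret S: subgroup S G by fact
  interpret T: subgroup T H by fact
  interpret E: group_hom G H E using E by unfold_locales
  have img: "T <#>\<^bsub>H\<^esub> (E ` (S #>\<^bsub>G\<^esub> u)) = T #>\<^bsub>H\<^esub> E u" if u: "u \<in> carrier G" for u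
  proof (intro equalityI subsetI)
    fix z assume "z \<in> T <#>\<^bsub>H\<^esub> (E ` (S #>\<^bsub>G\<^esub> u))"
    then obtain t s where ts: "t \<in> T" "s \<in> S" "z = t \<otimes>\<^bsub>H\<^esub> E (s \<otimes>\<^bsub>G\<^esub> u)"
      by (auto simp: set_mult_def r_coset_def)
    then have "z = (t \<otimes>\<^bsub>H\<^esub> E s) \<otimes>\<^bsub>H\<^esub> E u"
      using u by (simp add: H.m_assoc)
    moreover have "t \<otimes>\<^bsub>H\<^esub> E s \<in> T" using ts ST by blast
    ultimately show "z \<in> T #>\<^bsub>H\<^esub> E u" unfolding r_coset_def by blast
  next
    fix z assume "z \<in> T #>\<^bsub>H\<^esub> E u"
    then obtain t where "t \<in> T" "z = t \<otimes>\<^bsub>H\<^esub> E (\<one>\<^bsub>G\<^esub> \<otimes>\<^bsub>G\<^esub> u)"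
      using u by (auto simp: r_coset_def)
    then show "z \<in> T <#>\<^bsub>H\<^esub> (E ` (S #>\<^bsub>G\<^esub> u))"
      using S.one_closed unfolding set_mult_def r_coset_def by blast
  qed
  show ?thesis
  proof (intro iffI ballI impI inj_onI)
    fix u assume inj: "inj_on (\<lambda>C. T <#>\<^bsub>H\<^esub> (E ` C)) (carrier (G Mod S))"
      and u: "u \<in> carrier G" "E u \<in> T"
    have "T #>\<^bsub>H\<^esub> E u = T #>\<^bsub>H\<^esub> E \<one>\<^bsub>G\<^esub>"
      using u by (simp add: H.coset_join2 T T.subset)
    then have "S #>\<^bsub>G\<^esub> u = S #>\<^bsub>G\<^esub> \<one>\<^bsub>G\<^esub>"
      using u by (intro inj_onD[OF inj]) (auto simp: img carrier_FactGroup)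
    then show "u \<in> S" using u G.coset_join1[OF _ _ S] by (simp add: S.subset)
  next
    fix C C' assume ker: "\<forall>u \<in> carrier G. E u \<in> T \<longrightarrow> u \<in> S"
      and eq: "T <#>\<^bsub>H\<^esub> (E ` C) = T <#>\<^bsub>H\<^esub> (E ` C')"
      and "C \<in> carrier (G Mod S)" "C' \<in> carrier (G Mod S)"
    then obtain u v where uv: "u \<in> carrier G" "v \<in> carrier G" "C = S #>\<^bsub>G\<^esub> u" "C' = S #>\<^bsub>G\<^esub> v"
      by (auto simp: carrier_FactGroup)
    then have "T #>\<^bsub>H\<^esub> E u = T #>\<^bsub>H\<^esub> E v" using eq img by simp
    then have "E u \<otimes>\<^bsub>H\<^esub> inv\<^bsub>H\<^esub> E v \<in> T"
      using uv H.rcos_self[OF _ T, of "E u"] by (intro T.rcos_module_imp[OF H.is_group]) auto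
    then have "u \<otimes>\<^bsub>G\<^esub> inv\<^bsub>G\<^esub> v \<in> S" using ker uv by simp
    then have "u \<in> S #>\<^bsub>G\<^esub> v"
      using uv by (intro S.rcos_module_rev[OF G.is_group]) auto
    then show "C = C'" using uv G.repr_independence[OF _ _ S] by simp
  qed
qed

text \<open>The characters of the tensor product are represented by the balanced maps.\<close>

definition balanced_map ::
  "('r, 'k) ring_scheme \<Rightarrow> ('r, 'a, 'm) module_scheme \<Rightarrow> ('r, 'b, 'n) module_scheme
    \<Rightarrow> ('a \<Rightarrow> 'b \<Rightarrow> rat set) \<Rightarrow> bool"
  where "balanced_map R M A \<beta> \<longleftrightarrow>
    (\<forall>x \<in> carrier M. \<forall>a \<in> carrier A. \<beta> x a \<in> carrier rat_mod_int) \<and>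
    (\<forall>x \<in> carrier M. \<forall>y \<in> carrier M. \<forall>a \<in> carrier A.
      \<beta> (x \<oplus>\<^bsub>M\<^esub> y) a = \<beta> x a \<otimes>\<^bsub>rat_mod_int\<^esub> \<beta> y a) \<and>
    (\<forall>x \<in> carrier M. \<forall>a \<in> carrier A. \<forall>b \<in> carrier A.
      \<beta> x (a \<oplus>\<^bsub>A\<^esub> b) = \<beta> x a \<otimes>\<^bsub>rat_mod_int\<^esub> \<beta> x b) \<and>
    (\<forall>r \<in> carrier R. \<forall>x \<in> carrier M. \<forall>a \<in> carrier A.
      \<beta> (r \<odot>\<^bsub>M\<^esub> x) a = \<beta> x (r \<odot>\<^bsub>A\<^esub> a))"

lemma tensor_relations_subset:
  assumes "right_module R M" "left_module R A"
  shows "tensor_relations R M A \<subseteq> carrier (free_Abelian_group (carrier M \<times> carrier A))"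
proof -
  interpret M: right_module R M by fact
  interpret A: left_module R A by fact
  show ?thesis
    unfolding tensor_relations_def
    by (auto dest!: subsetD[OF keys_diff] simp: M.smult_closed A.smult_closed)
qed

lemma tensor_subgroup_subgroup:
  assumes "right_module R M" "left_module R A"
  shows "subgroup (tensor_subgroup R M A) (free_Abelian_group (carrier M \<times> carrier A))"
  unfolding tensor_subgroup_def
  by (intro group.generate_is_subgroup tensor_relations_subset assms) simp

lemma hom_free_Abelian_group_diff:
  assumes "group G" "\<chi> \<in> hom (free_Abelian_group S) G"
    "Poly_Mapping.keys u \<subseteq> S" "Poly_Mapping.keys v \<subseteq> S"
  shows "\<chi> (u - v) = \<chi> u \<otimes>\<^bsub>G\<^esub> inv\<^bsub>G\<^esub> \<chi> v"
proof -
  interpret group_hom "free_Abelian_group S" G \<chi>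
    using assms by (simp add: group_hom_def group_hom_axioms_def)
  show ?thesis
    using hom_mult[of u "- v"] hom_inv[of v] assms by simp
qed

lemma keys_diff_subset:
  "\<lbrakk>Poly_Mapping.keys u \<subseteq> S; Poly_Mapping.keys v \<subseteq> S\<rbrakk> \<Longrightarrow> Poly_Mapping.keys (u - v) \<subseteq> S"
  by (rule order_trans[OF keys_diff Un_least])

text \<open>A kernel is a subgroup, so only the generating relations matter, and triviality on each
  of the three kinds is one clause of balancedness.\<close>

lemma character_kills_tensor_subgroup_iff:
  assumes M: "right_module R M" and A: "left_module R A"
    and \<chi>: "\<chi> \<in> hom (free_Abelian_group (carrier M \<times> carrier A)) rat_mod_int"
  shows "(\<forall>s \<in> tensor_subgroup R M A. \<chi> s = \<one>\<^bsub>rat_mod_int\<^esub>) \<longleftrightarrow>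
    balanced_map R M A (\<lambda>x a. \<chi> (frag_of (x, a)))"
proof -
  interpret M: right_module R M by fact
  interpret A: left_module R A by fact
  let ?F = "free_Abelian_group (carrier M \<times> carrier A)"
  interpret \<chi>: group_hom ?F rat_mod_int \<chi>
    using \<chi> by (simp add: group_hom_def group_hom_axioms_def QZ.is_group)
  have closed: "\<chi> (frag_of (x, a)) \<in> carrier rat_mod_int" if "x \<in> carrier M" "a \<in> carrier A" for x a
    using that by (intro \<chi>.hom_closed) auto
  note diff = hom_free_Abelian_group_diff[OF QZ.is_group \<chi>]
  have "(\<forall>s \<in> tensor_subgroup R M A. \<chi> s = \<one>\<^bsub>rat_mod_int\<^esub>) \<longleftrightarrow>
    (\<forall>s \<in> tensor_relations R M A. \<chi> s = \<one>\<^bsub>rat_mod_int\<^esub>)"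
  proof
    assume *: "\<forall>s \<in> tensor_relations R M A. \<chi> s = \<one>\<^bsub>rat_mod_int\<^esub>"
    have "tensor_subgroup R M A \<subseteq> kernel ?F rat_mod_int \<chi>"
      unfolding tensor_subgroup_def
      using * tensor_relations_subset[OF M A]
      by (intro \<chi>.G.generate_subgroup_incl \<chi>.subgroup_kernel) (unfold kernel_def, blast)
    then show "\<forall>s \<in> tensor_subgroup R M A. \<chi> s = \<one>\<^bsub>rat_mod_int\<^esub>"
      by (auto simp: kernel_def)
  qed (auto simp: tensor_subgroup_def generate.incl)
  also have "\<dots> \<longleftrightarrow> balanced_map R M A (\<lambda>x a. \<chi> (frag_of (x, a)))"
  proof -
    have 0: "p \<otimes>\<^bsub>rat_mod_int\<^esub> inv\<^bsub>rat_mod_int\<^esub> a = \<one>\<^bsub>rat_mod_int\<^esub> \<longleftrightarrow> p = a"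
      if "p \<in> carrier rat_mod_int" "a \<in> carrier rat_mod_int" for p a
      using that by (metis QZ.inv_equality QZ.r_inv QZ.inv_closed)
    have 00: "p \<otimes>\<^bsub>rat_mod_int\<^esub> inv\<^bsub>rat_mod_int\<^esub> a \<otimes>\<^bsub>rat_mod_int\<^esub> inv\<^bsub>rat_mod_int\<^esub> b
        = \<one>\<^bsub>rat_mod_int\<^esub> \<longleftrightarrow> p = a \<otimes>\<^bsub>rat_mod_int\<^esub> b"
      if "p \<in> carrier rat_mod_int" "a \<in> carrier rat_mod_int" "b \<in> carrier rat_mod_int" for p a b
      using that 0[of p "a \<otimes>\<^bsub>rat_mod_int\<^esub> b"] by (simp add: QZ.inv_mult QZ.m_assoc)
    have 1: "\<chi> (frag_of (x \<oplus>\<^bsub>M\<^esub> y, a) - frag_of (x, a) - frag_of (y, a)) = \<one>\<^bsub>rat_mod_int\<^esub> \<longleftrightarrow>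
      \<chi> (frag_of (x \<oplus>\<^bsub>M\<^esub> y, a)) = \<chi> (frag_of (x, a)) \<otimes>\<^bsub>rat_mod_int\<^esub> \<chi> (frag_of (y, a))"
      if "x \<in> carrier M" "y \<in> carrier M" "a \<in> carrier A" for x y a
      using that closed by (simp add: diff keys_diff_subset 00)
    have 2: "\<chi> (frag_of (x, a \<oplus>\<^bsub>A\<^esub> b) - frag_of (x, a) - frag_of (x, b)) = \<one>\<^bsub>rat_mod_int\<^esub> \<longleftrightarrow>
      \<chi> (frag_of (x, a \<oplus>\<^bsub>A\<^esub> b)) = \<chi> (frag_of (x, a)) \<otimes>\<^bsub>rat_mod_int\<^esub> \<chi> (frag_of (x, b))"
      if "x \<in> carrier M" "a \<in> carrier A" "b \<in> carrier A" for x a b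
      using that closed by (simp add: diff keys_diff_subset 00)
    have 3: "\<chi> (frag_of (r \<odot>\<^bsub>M\<^esub> x, a) - frag_of (x, r \<odot>\<^bsub>A\<^esub> a)) = \<one>\<^bsub>rat_mod_int\<^esub> \<longleftrightarrow>
      \<chi> (frag_of (r \<odot>\<^bsub>M\<^esub> x, a)) = \<chi> (frag_of (x, r \<odot>\<^bsub>A\<^esub> a))"
      if "r \<in> carrier R" "x \<in> carrier M" "a \<in> carrier A" for r x a
      using that closed
      by (simp add: diff 0 M.smult_closed A.smult_closed)
    have "(\<forall>s \<in> tensor_relations R M A. \<chi> s = \<one>\<^bsub>rat_mod_int\<^esub>) \<longleftrightarrow>
      (\<forall>x \<in> carrier M. \<forall>y \<in> carrier M. \<forall>a \<in> carrier A.
        \<chi> (frag_of (x \<oplus>\<^bsub>M\<^esub> y, a) - frag_of (x, a) - frag_of (y, a)) = \<one>\<^bsub>rat_mod_int\<^esub>) \<and>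
      (\<forall>x \<in> carrier M. \<forall>a \<in> carrier A. \<forall>b \<in> carrier A.
        \<chi> (frag_of (x, a \<oplus>\<^bsub>A\<^esub> b) - frag_of (x, a) - frag_of (x, b)) = \<one>\<^bsub>rat_mod_int\<^esub>) \<and>
      (\<forall>r \<in> carrier R. \<forall>x \<in> carrier M. \<forall>a \<in> carrier A.
        \<chi> (frag_of (r \<odot>\<^bsub>M\<^esub> x, a) - frag_of (x, r \<odot>\<^bsub>A\<^esub> a)) = \<one>\<^bsub>rat_mod_int\<^esub>)"
      unfolding tensor_relations_def ball_Un conj_assoc
      by (intro arg_cong2[where f = "(\<and>)"]) blast+
    also have "\<dots> \<longleftrightarrow> balanced_map R M A (\<lambda>x a. \<chi> (frag_of (x, a)))"
      unfolding balanced_map_def by (simp add: 1 2 3 closed cong: ball_cong)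
    finally show ?thesis .
  qed
  finally show ?thesis .
qed

text \<open>The values on pairs extend by the universal property of the free group, and being
  balanced makes the extension factor through the tensor product.\<close>

lemma character_of_balanced_map:
  assumes M: "right_module R M" and A: "left_module R A" and \<beta>: "balanced_map R M A \<beta>"
  obtains \<chi> where "\<chi> \<in> hom (free_Abelian_group (carrier M \<times> carrier A)) rat_mod_int"
    "\<And>x a. \<lbrakk>x \<in> carrier M; a \<in> carrier A\<rbrakk> \<Longrightarrow> \<chi> (frag_of (x, a)) = \<beta> x a"
    "\<And>s. s \<in> tensor_subgroup R M A \<Longrightarrow> \<chi> s = \<one>\<^bsub>rat_mod_int\<^esub>"
proof -
  interpret M: right_module R M by fact
  interpret A: left_module R A by fact
  have "case_prod \<beta> ` (carrier M \<times> carrier A) \<subseteq> carrier rat_mod_int"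
    using \<beta> by (auto simp: balanced_map_def)
  then obtain \<chi> where \<chi>: "\<chi> \<in> hom (free_Abelian_group (carrier M \<times> carrier A)) rat_mod_int"
    and eq: "\<And>x. x \<in> carrier M \<times> carrier A \<Longrightarrow> \<chi> (frag_of x) = case_prod \<beta> x"
    using QZ.free_Abelian_group_universal by blast
  have "balanced_map R M A (\<lambda>x a. \<chi> (frag_of (x, a)))"
    using \<beta> by (simp add: balanced_map_def eq M.smult_closed A.smult_closed)
  then have "\<forall>s \<in> tensor_subgroup R M A. \<chi> s = \<one>\<^bsub>rat_mod_int\<^esub>"
    using character_kills_tensor_subgroup_iff[OF M A \<chi>] by blast
  with that[OF \<chi>] eq show thesis by auto
qed

section \<open>Module homomorphisms and injectivity of their tensor products\<close>

lemma module_homD: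
  assumes "f \<in> module_hom R M N"
  shows "\<And>x. x \<in> carrier M \<Longrightarrow> f x \<in> carrier N"
    and "\<And>x y. \<lbrakk>x \<in> carrier M; y \<in> carrier M\<rbrakk> \<Longrightarrow> f (x \<oplus>\<^bsub>M\<^esub> y) = f x \<oplus>\<^bsub>N\<^esub> f y"
    and "\<And>r x. \<lbrakk>r \<in> carrier R; x \<in> carrier M\<rbrakk> \<Longrightarrow> f (r \<odot>\<^bsub>M\<^esub> x) = r \<odot>\<^bsub>N\<^esub> f x"
  using assms by (auto simp: module_hom_def hom_def)

lemma module_homI:
  assumes "\<And>x. x \<in> carrier M \<Longrightarrow> f x \<in> carrier N"
    and "\<And>x y. \<lbrakk>x \<in> carrier M; y \<in> carrier M\<rbrakk> \<Longrightarrow> f (x \<oplus>\<^bsub>M\<^esub> y) = f x \<oplus>\<^bsub>N\<^esub> f y"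
    and "\<And>r x. \<lbrakk>r \<in> carrier R; x \<in> carrier M\<rbrakk> \<Longrightarrow> f (r \<odot>\<^bsub>M\<^esub> x) = r \<odot>\<^bsub>N\<^esub> f x"
  shows "f \<in> module_hom R M N"
  using assms by (auto simp: module_hom_def hom_def)

text \<open>Both arguments are allowed to vary so as to cover the inclusion of a submodule tensored
  with an identity, for purity, and an identity tensored with an injection, for flatness.\<close>

locale tensor_of_homs =
  M: right_module R M + M': right_module R M' + A: left_module R A + A': left_module R A'
  for R :: "('r, 'k) ring_scheme" (structure)
    and M :: "('r, 'a, 'm) module_scheme" and M' :: "('r, 'c, 'p) module_scheme"
    and A :: "('r, 'b, 'n) module_scheme" and A' :: "('r, 'd, 'q) module_scheme" +
  fixes f g
  assumes f: "f \<in> module_hom R M M'" and g: "g \<in> module_hom R A A'"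
begin

abbreviation frag_map :: "('a \<times> 'b \<Rightarrow>\<^sub>0 int) \<Rightarrow> ('c \<times> 'd \<Rightarrow>\<^sub>0 int)"
  where "frag_map \<equiv> frag_extend (\<lambda>(x, a). frag_of (f x, g a))"

lemma frag_map_hom:
  "frag_map \<in> hom (free_Abelian_group (carrier M \<times> carrier A)) (free_Abelian_group (carrier M' \<times> carrier A'))"
proof (rule homI)
  fix u assume "u \<in> carrier (free_Abelian_group (carrier M \<times> carrier A))"
  then have u: "Poly_Mapping.keys u \<subseteq> carrier M \<times> carrier A" by simp
  have "Poly_Mapping.keys (case p of (x, a) \<Rightarrow> frag_of (f x, g a)) \<subseteq> carrier M' \<times> carrier A'"
    if "p \<in> Poly_Mapping.keys u" for p
    using subsetD[OF u that] by (auto simp: module_homD(1)[OF f] module_homD(1)[OF g])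
  then show "frag_map u \<in> carrier (free_Abelian_group (carrier M' \<times> carrier A'))"
    unfolding carrier_free_Abelian_group_iff
    by (intro order_trans[OF keys_frag_extend] UN_least)
qed (simp add: frag_extend_add)

text \<open>Relations go to relations of the same kind. This is what lets the linear extension
  descend to the tensor products.\<close>

lemma frag_map_tensor_subgroup: "frag_map ` tensor_subgroup R M A \<subseteq> tensor_subgroup R M' A'"
proof -
  let ?F = "free_Abelian_group (carrier M \<times> carrier A)"
  let ?F' = "free_Abelian_group (carrier M' \<times> carrier A')"
  interpret E: group_hom ?F ?F' frag_map
    using frag_map_hom by (simp add: group_hom_def group_hom_axioms_def)
  have "frag_map ` tensor_relations R M A \<subseteq> tensor_relations R M' A'"
  proof
    fix v assume "v \<in> frag_map ` tensor_relations R M A"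
    then obtain u where v: "v = frag_map u" and "u \<in> tensor_relations R M A" by blast
    then consider
        (1) x y a where "x \<in> carrier M" "y \<in> carrier M" "a \<in> carrier A"
          "u = frag_of (x \<oplus>\<^bsub>M\<^esub> y, a) - frag_of (x, a) - frag_of (y, a)"
      | (2) x a b where "x \<in> carrier M" "a \<in> carrier A" "b \<in> carrier A"
          "u = frag_of (x, a \<oplus>\<^bsub>A\<^esub> b) - frag_of (x, a) - frag_of (x, b)"
      | (3) r x a where "r \<in> carrier R" "x \<in> carrier M" "a \<in> carrier A"
          "u = frag_of (r \<odot>\<^bsub>M\<^esub> x, a) - frag_of (x, r \<odot>\<^bsub>A\<^esub> a)"
      by (auto simp: tensor_relations_def)
    then show "v \<in> tensor_relations R M' A'"
    proof cases
      case 1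
      then have "v = frag_of (f x \<oplus>\<^bsub>M'\<^esub> f y, g a) - frag_of (f x, g a) - frag_of (f y, g a)"
        by (simp add: v frag_extend_diff module_homD(2)[OF f])
      then show ?thesis
        using 1 module_homD(1)[OF f] module_homD(1)[OF g] unfolding tensor_relations_def by blast
    next
      case 2
      then have "v = frag_of (f x, g a \<oplus>\<^bsub>A'\<^esub> g b) - frag_of (f x, g a) - frag_of (f x, g b)"
        by (simp add: v frag_extend_diff module_homD(2)[OF g])
      then show ?thesis
        using 2 module_homD(1)[OF f] module_homD(1)[OF g] unfolding tensor_relations_def by blast
    next
      case 3
      then have "v = frag_of (r \<odot>\<^bsub>M'\<^esub> f x, g a) - frag_of (f x, r \<odot>\<^bsub>A'\<^esub> g a)"
        by (simp add: v frag_extend_diff module_homD(3)[OF f] module_homD(3)[OF g])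
      then show ?thesis
        using 3 module_homD(1)[OF f] module_homD(1)[OF g] unfolding tensor_relations_def by blast
    qed
  qed
  then have "generate ?F' (frag_map ` tensor_relations R M A) \<subseteq> tensor_subgroup R M' A'"
    unfolding tensor_subgroup_def by (intro E.H.mono_generate)
  then show ?thesis
    unfolding tensor_subgroup_def
    using E.generate_img[OF tensor_relations_subset[OF M.right_module_axioms A.left_module_axioms]]
    by simp
qed

lemma tensor_map_inj_on_iff:
  "inj_on (tensor_map R M' A' f g) (carrier (tensor_product R M A)) \<longleftrightarrow>
    (\<forall>u \<in> carrier (free_Abelian_group (carrier M \<times> carrier A)).
      frag_map u \<in> tensor_subgroup R M' A' \<longrightarrow> u \<in> tensor_subgroup R M A)"
  unfolding tensor_map_def[abs_def] tensor_product_def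
  by (intro FactGroup_map_inj_on_iff abelian_free_Abelian_group frag_map_hom frag_map_tensor_subgroup
      tensor_subgroup_subgroup M.right_module_axioms M'.right_module_axioms
      A.left_module_axioms A'.left_module_axioms)

text \<open>
  The map \<open>f \<otimes> g\<close> is injective iff the map induced on character groups is surjective.
\<close>

lemma tensor_map_inj_onI:
  assumes ext: "\<And>\<beta>. balanced_map R M A \<beta> \<Longrightarrow>
    \<exists>\<beta>'. balanced_map R M' A' \<beta>' \<and> (\<forall>x \<in> carrier M. \<forall>a \<in> carrier A. \<beta>' (f x) (g a) = \<beta> x a)"
  shows "inj_on (tensor_map R M' A' f g) (carrier (tensor_product R M A))"
  unfolding tensor_map_inj_on_iff
proof (intro ballI impI, rule ccontr)
  let ?F = "free_Abelian_group (carrier M \<times> carrier A)"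
  let ?F' = "free_Abelian_group (carrier M' \<times> carrier A')"
  fix u assume u: "u \<in> carrier ?F" "frag_map u \<in> tensor_subgroup R M' A'" "u \<notin> tensor_subgroup R M A"
  \<comment> \<open>An element \<open>u\<close> violating the criterion is detected by a character
    of the domain. Extending its balanced map yields a character \<open>\<chi>'\<close> with the
    same value at \<open>frag_map u\<close>, which is trivial there because
    \<open>frag_map u\<close> is a relation.\<close>
  obtain \<chi> where \<chi>: "\<chi> \<in> hom ?F rat_mod_int" and ker: "\<And>s. s \<in> tensor_subgroup R M A \<Longrightarrow> \<chi> s = \<one>\<^bsub>rat_mod_int\<^esub>"
    and "\<chi> u \<noteq> \<one>\<^bsub>rat_mod_int\<^esub>"
    by (rule character_separates[OF abelian_free_Abelian_group
        tensor_subgroup_subgroup[OF M.right_module_axioms A.left_module_axioms] u(1,3)]) blast+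
  have "balanced_map R M A (\<lambda>x a. \<chi> (frag_of (x, a)))"
    using ker character_kills_tensor_subgroup_iff[OF M.right_module_axioms A.left_module_axioms \<chi>] by blast
  from ext[OF this] obtain \<beta>' where \<beta>': "balanced_map R M' A' \<beta>'"
    and eq: "\<And>x a. \<lbrakk>x \<in> carrier M; a \<in> carrier A\<rbrakk> \<Longrightarrow> \<beta>' (f x) (g a) = \<chi> (frag_of (x, a))"
    by auto
  obtain \<chi>' where \<chi>': "\<chi>' \<in> hom ?F' rat_mod_int"
    and eq': "\<And>x a. \<lbrakk>x \<in> carrier M'; a \<in> carrier A'\<rbrakk> \<Longrightarrow> \<chi>' (frag_of (x, a)) = \<beta>' x a"
    and ker': "\<And>s. s \<in> tensor_subgroup R M' A' \<Longrightarrow> \<chi>' s = \<one>\<^bsub>rat_mod_int\<^esub>"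
    by (rule character_of_balanced_map[OF M'.right_module_axioms A'.left_module_axioms \<beta>']) blast+
  \<comment> \<open>The difference case of the induction says nothing about supports, so the bound
    on the support is carried as part of the claim.\<close>
  have "Poly_Mapping.keys v \<subseteq> carrier M \<times> carrier A \<and> \<chi>' (frag_map v) = \<chi> v"
    if "Poly_Mapping.keys v \<subseteq> carrier M \<times> carrier A" for v
    using that
  proof (induction v rule: frag_induction)
    case zero
    show ?case
      using hom_one[OF \<chi>] hom_one[OF \<chi>'] by (simp add: QZ.is_group)
  next
    case (one p)
    then show ?case
      using module_homD(1)[OF f] module_homD(1)[OF g] by (auto simp: eq eq')
  next
    case (diff v w)
    have "Poly_Mapping.keys (frag_map v) \<subseteq> carrier M' \<times> carrier A'"
      if "Poly_Mapping.keys v \<subseteq> carrier M \<times> carrier A" for v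
      using hom_in_carrier[OF frag_map_hom, of v] that by simp
    with diff show ?case
      by (simp add: frag_extend_diff hom_free_Abelian_group_diff[OF QZ.is_group \<chi>]
          hom_free_Abelian_group_diff[OF QZ.is_group \<chi>'] keys_diff_subset)
  qed
  then have "\<chi>' (frag_map u) = \<chi> u" using u by simp
  with u ker' \<open>\<chi> u \<noteq> \<one>\<^bsub>rat_mod_int\<^esub>\<close> show False by simp
qed

text \<open>The converse direction: injectivity says that whatever \<open>frag_map\<close> sends
  into the relations is already a relation, hence killed by the given character. This is the
  compatibility condition \<open>ker\<close> of \<open>QZ.hom_extend\<close>.\<close>

lemma balanced_map_extend:
  assumes inj: "inj_on (tensor_map R M' A' f g) (carrier (tensor_product R M A))"
    and \<beta>: "balanced_map R M A \<beta>"
  obtains \<beta>' where "balanced_map R M' A' \<beta>'"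
    "\<And>x a. \<lbrakk>x \<in> carrier M; a \<in> carrier A\<rbrakk> \<Longrightarrow> \<beta>' (f x) (g a) = \<beta> x a"
proof -
  let ?F = "free_Abelian_group (carrier M \<times> carrier A)"
  let ?F' = "free_Abelian_group (carrier M' \<times> carrier A')"
  obtain \<chi> where \<chi>: "\<chi> \<in> hom ?F rat_mod_int"
    and eq: "\<And>x a. \<lbrakk>x \<in> carrier M; a \<in> carrier A\<rbrakk> \<Longrightarrow> \<chi> (frag_of (x, a)) = \<beta> x a"
    and ker: "\<And>s. s \<in> tensor_subgroup R M A \<Longrightarrow> \<chi> s = \<one>\<^bsub>rat_mod_int\<^esub>"
    by (rule character_of_balanced_map[OF M.right_module_axioms A.left_module_axioms \<beta>]) blast+
  have "\<chi> u = \<one>\<^bsub>rat_mod_int\<^esub>" if "u \<in> carrier ?F" "frag_map u \<in> tensor_subgroup R M' A'" for u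
    using that inj ker unfolding tensor_map_inj_on_iff by blast
  then obtain \<psi> where \<psi>: "\<psi> \<in> hom ?F' rat_mod_int"
    "\<And>t. t \<in> tensor_subgroup R M' A' \<Longrightarrow> \<psi> t = \<one>\<^bsub>rat_mod_int\<^esub>"
    "\<And>u. u \<in> carrier ?F \<Longrightarrow> \<psi> (frag_map u) = \<chi> u"
    by (rule QZ.hom_extend[OF abelian_free_Abelian_group group_free_Abelian_group frag_map_hom
        tensor_subgroup_subgroup[OF M'.right_module_axioms A'.left_module_axioms] \<chi>]) blast+
  show thesis
  proof
    show "balanced_map R M' A' (\<lambda>x a. \<psi> (frag_of (x, a)))"
      using \<psi> character_kills_tensor_subgroup_iff[OF M'.right_module_axioms A'.left_module_axioms \<psi>(1)] by blast
    show "\<psi> (frag_of (f x, g a)) = \<beta> x a" if "x \<in> carrier M" "a \<in> carrier A" for x a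
      using \<psi>(3)[of "frag_of (x, a)"] that by (simp add: eq)
  qed
qed

end

section \<open>Character modules and purity\<close>

lemma add_monoid_carrier_update: "add_monoid (M\<lparr>carrier := N\<rparr>) = (add_monoid M)\<lparr>carrier := N\<rparr>"
  by simp

lemma right_module_submodule:
  assumes "right_module R M" "submodule N R M"
  shows "right_module R (M\<lparr>carrier := N\<rparr>)"
proof -
  interpret M: right_module R M by fact
  interpret N: submodule N R M by fact
  have "comm_group ((add_monoid M)\<lparr>carrier := N\<rparr>)"
    by (rule group.group_comm_groupI[OF N.subgroup_is_group[OF M.a_group]])
      (simp add: M.a_comm subsetD[OF N.subset, simplified])
  then interpret MN: abelian_group "M\<lparr>carrier := N\<rparr>"
    by (intro abelian_group.intro abelian_monoid.intro abelian_group_axioms.intro)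
      (simp_all add: comm_group_def)
  have "x \<in> carrier M" if "x \<in> N" for x
    using subsetD[OF N.subset that] by simp
  then show ?thesis
    by unfold_locales (simp_all add: M.smult_l_distr M.smult_r_distr M.smult_assoc M.smult_one)
qed

lemma (in right_module) smult_group_hom:
  assumes "r \<in> carrier R"
  shows "group_hom (add_monoid M) (add_monoid M) (\<lambda>x. r \<odot>\<^bsub>M\<^esub> x)"
  using assms by unfold_locales (auto simp: hom_def smult_closed smult_r_distr)

section \<open>Characters as a left module and their extension from submodules\<close>

lemma character_module_simps [simp]:
  "\<zero>\<^bsub>character_module M\<^esub> = (\<lambda>x \<in> carrier M. \<one>\<^bsub>rat_mod_int\<^esub>)"
  "\<phi> \<oplus>\<^bsub>character_module M\<^esub> \<psi> = (\<lambda>x \<in> carrier M. \<phi> x \<otimes>\<^bsub>rat_mod_int\<^esub> \<psi> x)"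
  "r \<odot>\<^bsub>character_module M\<^esub> \<phi> = (\<lambda>x \<in> carrier M. \<phi> (r \<odot>\<^bsub>M\<^esub> x))"
  by (simp_all add: character_module_def)

lemma character_moduleI:
  assumes "\<And>x. x \<in> carrier M \<Longrightarrow> \<phi> x \<in> carrier rat_mod_int"
    and "\<And>x y. \<lbrakk>x \<in> carrier M; y \<in> carrier M\<rbrakk> \<Longrightarrow> \<phi> (x \<oplus>\<^bsub>M\<^esub> y) = \<phi> x \<otimes>\<^bsub>rat_mod_int\<^esub> \<phi> y"
    and "\<phi> \<in> extensional (carrier M)"
  shows "\<phi> \<in> carrier (character_module M)"
  using assms by (auto simp: character_module_def hom_def)

lemma character_moduleD:
  assumes "\<phi> \<in> carrier (character_module M)"
  shows "\<And>x. x \<in> carrier M \<Longrightarrow> \<phi> x \<in> carrier rat_mod_int"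
    and "\<And>x y. \<lbrakk>x \<in> carrier M; y \<in> carrier M\<rbrakk> \<Longrightarrow> \<phi> (x \<oplus>\<^bsub>M\<^esub> y) = \<phi> x \<otimes>\<^bsub>rat_mod_int\<^esub> \<phi> y"
    and "\<phi> \<in> extensional (carrier M)"
  using assms by (auto simp: character_module_def hom_def)

lemma character_eqI:
  assumes "\<phi> \<in> carrier (character_module M)" "\<psi> \<in> carrier (character_module M)"
    and "\<And>x. x \<in> carrier M \<Longrightarrow> \<phi> x = \<psi> x"
  shows "\<phi> = \<psi>"
  using character_moduleD(3)[OF assms(1)] character_moduleD(3)[OF assms(2)] assms(3)
  by (rule extensionalityI)

lemma left_module_character_module:
  assumes "right_module R M"
  shows "left_module R (character_module M)"
proof -
  interpret M: right_module R M by fact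
  let ?L = "character_module M"
  have add: "\<phi> \<oplus>\<^bsub>?L\<^esub> \<psi> \<in> carrier ?L" if "\<phi> \<in> carrier ?L" "\<psi> \<in> carrier ?L" for \<phi> \<psi>
    using that by (intro character_moduleI) (auto simp: character_moduleD(1,2) QZ.m_ac)
  have zero: "\<zero>\<^bsub>?L\<^esub> \<in> carrier ?L" by (intro character_moduleI) auto
  have smult: "r \<odot>\<^bsub>?L\<^esub> \<phi> \<in> carrier ?L" if "r \<in> carrier R" "\<phi> \<in> carrier ?L" for r \<phi>
    using that by (intro character_moduleI) (auto simp: character_moduleD(1,2) M.smult_closed M.smult_r_distr)
  have ab: "abelian_group ?L"
  proof (rule abelian_groupI)
    show "\<exists>\<psi>\<in>carrier ?L. \<psi> \<oplus>\<^bsub>?L\<^esub> \<phi> = \<zero>\<^bsub>?L\<^esub>" if \<phi>: "\<phi> \<in> carrier ?L" for \<phi>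
    proof (rule bexI)
      show "(\<lambda>x \<in> carrier M. inv\<^bsub>rat_mod_int\<^esub> \<phi> x) \<in> carrier ?L"
        by (intro character_moduleI) (auto simp: character_moduleD(1,2)[OF \<phi>] QZ.inv_mult)
    qed (auto intro!: restrict_ext simp: character_moduleD(1,2)[OF \<phi>])
  qed (auto intro!: character_eqI add zero simp del: character_module_simps,
      auto intro!: restrict_ext extensionalityI simp: character_moduleD QZ.m_ac)
  show ?thesis
  proof (intro left_module.intro left_module_axioms.intro M.ring_axioms ab)
    fix r s \<phi> \<psi> assume r: "r \<in> carrier R" "s \<in> carrier R" and \<phi>: "\<phi> \<in> carrier ?L" "\<psi> \<in> carrier ?L"
    show "r \<odot>\<^bsub>?L\<^esub> \<phi> \<in> carrier ?L" by (rule smult[OF r(1) \<phi>(1)])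
    show "(r \<oplus>\<^bsub>R\<^esub> s) \<odot>\<^bsub>?L\<^esub> \<phi> = r \<odot>\<^bsub>?L\<^esub> \<phi> \<oplus>\<^bsub>?L\<^esub> s \<odot>\<^bsub>?L\<^esub> \<phi>"
      using r by (auto intro!: restrict_ext simp: M.smult_l_distr M.smult_closed character_moduleD(2)[OF \<phi>(1)])
    show "r \<odot>\<^bsub>?L\<^esub> (\<phi> \<oplus>\<^bsub>?L\<^esub> \<psi>) = r \<odot>\<^bsub>?L\<^esub> \<phi> \<oplus>\<^bsub>?L\<^esub> r \<odot>\<^bsub>?L\<^esub> \<psi>"
      using r by (auto intro!: restrict_ext simp: M.smult_closed)
    show "(r \<otimes>\<^bsub>R\<^esub> s) \<odot>\<^bsub>?L\<^esub> \<phi> = r \<odot>\<^bsub>?L\<^esub> (s \<odot>\<^bsub>?L\<^esub> \<phi>)"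
      using r by (auto intro!: restrict_ext simp: M.smult_closed M.smult_assoc)
  next
    fix \<phi> assume \<phi>: "\<phi> \<in> carrier ?L"
    show "\<one>\<^bsub>R\<^esub> \<odot>\<^bsub>?L\<^esub> \<phi> = \<phi>"
      by (intro extensionalityI[of _ "carrier M"])
        (auto simp: M.smult_one character_moduleD(3)[OF \<phi>])
  qed
qed

text \<open>The case of \<open>QZ.hom_extend\<close> where \<open>E\<close> is the inclusion and
  \<open>T\<close> is trivial. Only additivity is extended here; linearity in a parameter is left to
  the projection.\<close>

lemma character_extend:
  assumes "right_module R M" "submodule N R M"
    and "\<And>x. x \<in> N \<Longrightarrow> \<phi> x \<in> carrier rat_mod_int"
    and "\<And>x y. \<lbrakk>x \<in> N; y \<in> N\<rbrakk> \<Longrightarrow> \<phi> (x \<oplus>\<^bsub>M\<^esub> y) = \<phi> x \<otimes>\<^bsub>rat_mod_int\<^esub> \<phi> y"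
  obtains \<psi> where "\<psi> \<in> carrier (character_module M)" "\<And>x. x \<in> N \<Longrightarrow> \<psi> x = \<phi> x"
proof -
  interpret M: right_module R M by fact
  interpret N: submodule N R M by fact
  let ?N = "(add_monoid M)\<lparr>carrier := N\<rparr>"
  have N: "group ?N" by (rule N.subgroup_is_group[OF M.a_group])
  have E: "(\<lambda>x. x) \<in> hom ?N (add_monoid M)" using N.subset by (auto simp: hom_def)
  have \<phi>: "\<phi> \<in> hom ?N rat_mod_int" using assms(3,4) by (auto simp: hom_def)
  have ker: "\<phi> u = \<one>\<^bsub>rat_mod_int\<^esub>" if "u \<in> {\<zero>\<^bsub>M\<^esub>}" for u
    using hom_one[OF \<phi> N QZ.is_group] that by simp
  have T: "subgroup {\<zero>\<^bsub>M\<^esub>} (add_monoid M)" using M.add.triv_subgroup by simp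
  obtain \<psi> where \<psi>: "\<psi> \<in> hom (add_monoid M) rat_mod_int" "\<And>u. u \<in> N \<Longrightarrow> \<psi> u = \<phi> u"
    by (rule QZ.hom_extend[OF M.a_comm_group N E T \<phi> ker]) auto
  show thesis
  proof
    show "restrict \<psi> (carrier M) \<in> carrier (character_module M)"
      using \<psi>(1) by (intro character_moduleI) (auto simp: hom_def)
    show "restrict \<psi> (carrier M) x = \<phi> x" if "x \<in> N" for x
      using that \<psi>(2) N.subset by auto
  qed
qed

text \<open>Both projections are returned, since \<open>\<kappa>\<close> serves for purity and
  \<open>\<pi>\<close> for flatness. They are linear because sums and multiples of decompositions
  are decompositions and the components are unique.\<close>

lemma direct_summand_projections:
  assumes L: "left_module R L" and P: "direct_summand R L P"
  obtains \<pi> \<kappa> where "\<pi> \<in> module_hom R L L" "\<kappa> \<in> module_hom R L L"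
    "\<And>x. x \<in> carrier L \<Longrightarrow> \<pi> x \<in> P" "\<And>x. x \<in> carrier L \<Longrightarrow> \<pi> x \<oplus>\<^bsub>L\<^esub> \<kappa> x = x"
    "\<And>x. x \<in> P \<Longrightarrow> \<pi> x = x" "\<And>x. x \<in> P \<Longrightarrow> \<kappa> x = \<zero>\<^bsub>L\<^esub>"
proof -
  interpret L: left_module R L by fact
  obtain K where "submodule P R L" "submodule K R L" and sum: "P <+>\<^bsub>L\<^esub> K = carrier L"
    and int: "P \<inter> K = {\<zero>\<^bsub>L\<^esub>}"
    using P by (auto simp: direct_summand_def)
  interpret P: submodule P R L by fact
  interpret K: submodule K R L by fact
  have Pc: "p \<in> carrier L" if "p \<in> P" for p using that P.subset by auto
  have Kc: "k \<in> carrier L" if "k \<in> K" for k using that K.subset by auto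
  have ex: "\<exists>d. fst d \<in> P \<and> snd d \<in> K \<and> fst d \<oplus>\<^bsub>L\<^esub> snd d = x" if "x \<in> carrier L" for x
    using that unfolding sum[symmetric] set_add_def' by fastforce
  have uniq: "p = p' \<and> k = k'"
    if pk: "p \<in> P" "k \<in> K" "p' \<in> P" "k' \<in> K" and eq: "p \<oplus>\<^bsub>L\<^esub> k = p' \<oplus>\<^bsub>L\<^esub> k'" for p k p' k'
  proof -
    note c = Pc[OF pk(1)] Kc[OF pk(2)] Pc[OF pk(3)] Kc[OF pk(4)]
    have "p \<ominus>\<^bsub>L\<^esub> p' = k' \<ominus>\<^bsub>L\<^esub> k"
    proof -
      have "\<ominus>\<^bsub>L\<^esub> p' \<oplus>\<^bsub>L\<^esub> (p \<oplus>\<^bsub>L\<^esub> k) = k'"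
        using c eq by (intro L.a_transpose_inv) auto
      then have "k' = (p \<ominus>\<^bsub>L\<^esub> p') \<oplus>\<^bsub>L\<^esub> k"
        using c by (simp add: a_minus_def L.a_ac)
      then show ?thesis
        using c L.add.inv_solve_right[of "p \<ominus>\<^bsub>L\<^esub> p'" k' k] by (simp add: a_minus_def)
    qed
    moreover have "p \<ominus>\<^bsub>L\<^esub> p' \<in> P" "k' \<ominus>\<^bsub>L\<^esub> k \<in> K"
      using P.m_closed[OF pk(1) P.m_inv_closed[OF pk(3)]] K.m_closed[OF pk(4) K.m_inv_closed[OF pk(2)]]
      by (simp_all add: a_minus_def a_inv_def)
    ultimately have "p \<ominus>\<^bsub>L\<^esub> p' = \<zero>\<^bsub>L\<^esub>" "k' \<ominus>\<^bsub>L\<^esub> k = \<zero>\<^bsub>L\<^esub>" using int by auto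
    then show ?thesis
      using c L.add.inv_solve_right[of "\<zero>\<^bsub>L\<^esub>" p p'] L.add.inv_solve_right[of "\<zero>\<^bsub>L\<^esub>" k' k]
      by (simp add: a_minus_def)
  qed
  define d where "d x = (SOME d. fst d \<in> P \<and> snd d \<in> K \<and> fst d \<oplus>\<^bsub>L\<^esub> snd d = x)" for x
  have d: "fst (d x) \<in> P" "snd (d x) \<in> K" "fst (d x) \<oplus>\<^bsub>L\<^esub> snd (d x) = x" if "x \<in> carrier L" for x
    using someI_ex[OF ex[OF that]] by (simp_all add: d_def)
  \<comment> \<open>Recognizes the chosen components from any decomposition of \<open>x\<close>, so
    the choice need not be inspected again.\<close>
  have dI: "fst (d x) = p \<and> snd (d x) = k" if "p \<in> P" "k \<in> K" "p \<oplus>\<^bsub>L\<^esub> k = x" for x p k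
  proof -
    have "x \<in> carrier L" using that Pc Kc by auto
    then show ?thesis using d[of x] that by (intro uniq) auto
  qed
  have add: "fst (d (x \<oplus>\<^bsub>L\<^esub> y)) = fst (d x) \<oplus>\<^bsub>L\<^esub> fst (d y) \<and> snd (d (x \<oplus>\<^bsub>L\<^esub> y)) = snd (d x) \<oplus>\<^bsub>L\<^esub> snd (d y)"
    if "x \<in> carrier L" "y \<in> carrier L" for x y
  proof (rule dI)
    note c = Pc[OF d(1)[OF that(1)]] Kc[OF d(2)[OF that(1)]] Pc[OF d(1)[OF that(2)]] Kc[OF d(2)[OF that(2)]]
    have "fst (d x) \<oplus>\<^bsub>L\<^esub> fst (d y) \<oplus>\<^bsub>L\<^esub> (snd (d x) \<oplus>\<^bsub>L\<^esub> snd (d y)) =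
      (fst (d x) \<oplus>\<^bsub>L\<^esub> snd (d x)) \<oplus>\<^bsub>L\<^esub> (fst (d y) \<oplus>\<^bsub>L\<^esub> snd (d y))"
      using c by (simp add: L.a_ac)
    then show "fst (d x) \<oplus>\<^bsub>L\<^esub> fst (d y) \<oplus>\<^bsub>L\<^esub> (snd (d x) \<oplus>\<^bsub>L\<^esub> snd (d y)) = x \<oplus>\<^bsub>L\<^esub> y"
      using d(3) that by simp
    show "fst (d x) \<oplus>\<^bsub>L\<^esub> fst (d y) \<in> P" using P.m_closed[of "fst (d x)" "fst (d y)"] d that by simp
    show "snd (d x) \<oplus>\<^bsub>L\<^esub> snd (d y) \<in> K" using K.m_closed[of "snd (d x)" "snd (d y)"] d that by simp
  qed
  have smult: "fst (d (r \<odot>\<^bsub>L\<^esub> x)) = r \<odot>\<^bsub>L\<^esub> fst (d x) \<and> snd (d (r \<odot>\<^bsub>L\<^esub> x)) = r \<odot>\<^bsub>L\<^esub> snd (d x)"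
    if "r \<in> carrier R" "x \<in> carrier L" for r x
  proof (rule dI)
    show "r \<odot>\<^bsub>L\<^esub> fst (d x) \<oplus>\<^bsub>L\<^esub> r \<odot>\<^bsub>L\<^esub> snd (d x) = r \<odot>\<^bsub>L\<^esub> x"
      using L.smult_r_distr[OF that(1) Pc[OF d(1)[OF that(2)]] Kc[OF d(2)[OF that(2)]]] d(3)[OF that(2)] by simp
  qed (use d that in auto)
  have P0: "fst (d x) = x \<and> snd (d x) = \<zero>\<^bsub>L\<^esub>" if "x \<in> P" for x
    using that Pc K.one_closed by (intro dI) auto
  show thesis
  proof
    show "(\<lambda>x. fst (d x)) \<in> module_hom R L L" "(\<lambda>x. snd (d x)) \<in> module_hom R L L"
      using d add smult Pc Kc by (auto intro!: module_homI)
  qed (use d P0 in auto)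
qed

text \<open>The kernel of the restriction of characters from \<open>M\<close> to
  \<open>N\<close>.\<close>

definition annihilator :: "('r, 'a, 'm) module_scheme \<Rightarrow> 'a set \<Rightarrow> ('a \<Rightarrow> rat set) set"
  where "annihilator M N =
    {\<phi> \<in> carrier (character_module M). \<forall>x \<in> N. \<phi> x = \<one>\<^bsub>rat_mod_int\<^esub>}"

text \<open>
  The complement of the annihilator provides an \<open>R\<close>-linear extension of characters from \<open>N\<close> to \<open>M\<close>.
\<close>

lemma pure_submodule_if_annihilator_summand:
  fixes R :: "('r, 'k) ring_scheme" and M :: "('r, 'a, 'm) module_scheme"
  assumes M: "right_module R M" and N: "submodule N R M"
    and sum: "direct_summand R (character_module M) (annihilator M N)"
  shows "pure_submodule TYPE('u) R M N"
  unfolding pure_submodule_def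
proof (intro conjI allI impI)
  show "submodule N R M" by fact
  fix A :: "('r, 'u) module" assume A: "left_module R A"
  let ?L = "character_module M"
  interpret M: right_module R M by fact
  interpret N: submodule N R M by fact
  interpret A: left_module R A by fact
  interpret MN: right_module R "M\<lparr>carrier := N\<rparr>" by (rule right_module_submodule[OF M N])
  interpret L: left_module R ?L by (rule left_module_character_module[OF M])
  interpret tensor_of_homs R "M\<lparr>carrier := N\<rparr>" M A A "\<lambda>x. x" "\<lambda>a. a"
    using N.subset by unfold_locales (auto intro!: module_homI)
  have Nc: "x \<in> carrier M" if "x \<in> N" for x using that N.subset by auto
  obtain \<pi> \<kappa> where \<kappa>: "\<kappa> \<in> module_hom R ?L ?L"
    and \<pi>: "\<And>\<phi>. \<phi> \<in> carrier ?L \<Longrightarrow> \<pi> \<phi> \<in> annihilator M N"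
    and \<pi>\<kappa>: "\<And>\<phi>. \<phi> \<in> carrier ?L \<Longrightarrow> \<pi> \<phi> \<oplus>\<^bsub>?L\<^esub> \<kappa> \<phi> = \<phi>"
    and ker: "\<And>\<phi>. \<phi> \<in> annihilator M N \<Longrightarrow> \<kappa> \<phi> = \<zero>\<^bsub>?L\<^esub>"
    by (rule direct_summand_projections[OF L.left_module_axioms sum]) blast
  note \<kappa>D = module_homD[OF \<kappa>]
  \<comment> \<open>Discarding the annihilator component does not change a character on
    \<open>N\<close>.\<close>
  have \<kappa>_N: "\<kappa> \<phi> x = \<phi> x" if \<phi>: "\<phi> \<in> carrier ?L" and x: "x \<in> N" for \<phi> x
  proof -
    have "\<phi> x = (\<pi> \<phi> \<oplus>\<^bsub>?L\<^esub> \<kappa> \<phi>) x" using \<pi>\<kappa>[OF \<phi>] by simp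
    also have "\<dots> = \<pi> \<phi> x \<otimes>\<^bsub>rat_mod_int\<^esub> \<kappa> \<phi> x" using Nc[OF x] by simp
    also have "\<dots> = \<kappa> \<phi> x"
      using \<pi>[OF \<phi>] x character_moduleD(1)[OF \<kappa>D(1)[OF \<phi>] Nc[OF x]] by (simp add: annihilator_def)
    finally show ?thesis by simp
  qed
  \<comment> \<open>The projection forgets which extension from \<open>N\<close> was chosen, since
    two of them differ by an element of the annihilator.\<close>
  have \<kappa>_cong: "\<kappa> \<phi> = \<kappa> \<psi>" if \<phi>: "\<phi> \<in> carrier ?L" and \<psi>: "\<psi> \<in> carrier ?L"
    and eq: "\<And>x. x \<in> N \<Longrightarrow> \<phi> x = \<psi> x" for \<phi> \<psi>
  proof -
    define \<delta> where "\<delta> = \<phi> \<ominus>\<^bsub>?L\<^esub> \<psi>"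
    have \<delta>: "\<delta> \<in> carrier ?L" unfolding \<delta>_def by (rule L.minus_closed[OF \<phi> \<psi>])
    have sum: "\<phi> = \<delta> \<oplus>\<^bsub>?L\<^esub> \<psi>"
      unfolding \<delta>_def a_minus_def using \<phi> \<psi> L.a_assoc[OF \<phi> L.a_inv_closed[OF \<psi>] \<psi>]
      by (simp add: L.l_neg del: character_module_simps)
    have "\<delta> x = \<one>\<^bsub>rat_mod_int\<^esub>" if x: "x \<in> N" for x
    proof -
      have "\<delta> x \<otimes>\<^bsub>rat_mod_int\<^esub> \<psi> x = \<psi> x"
        using fun_cong[OF sum, of x] eq[OF x] Nc[OF x] by simp
      then show ?thesis
        using character_moduleD(1)[OF \<delta> Nc[OF x]] character_moduleD(1)[OF \<psi> Nc[OF x]] by simp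
    qed
    then have "\<kappa> \<delta> = \<zero>\<^bsub>?L\<^esub>" using \<delta> by (intro ker) (simp add: annihilator_def)
    then show ?thesis
      using sum \<kappa>D(2)[OF \<delta> \<psi>] L.l_zero[OF \<kappa>D(1)[OF \<psi>]] by (simp del: character_module_simps)
  qed
  show "inj_on (tensor_map R M A (\<lambda>x. x) (\<lambda>a. a)) (carrier (tensor_product R (M\<lparr>carrier := N\<rparr>) A))"
  proof (rule tensor_map_inj_onI)
    fix \<beta> assume "balanced_map R (M\<lparr>carrier := N\<rparr>) A \<beta>"
    then have \<beta>: "\<And>x a. \<lbrakk>x \<in> N; a \<in> carrier A\<rbrakk> \<Longrightarrow> \<beta> x a \<in> carrier rat_mod_int"
      "\<And>x y a. \<lbrakk>x \<in> N; y \<in> N; a \<in> carrier A\<rbrakk> \<Longrightarrow> \<beta> (x \<oplus>\<^bsub>M\<^esub> y) a = \<beta> x a \<otimes>\<^bsub>rat_mod_int\<^esub> \<beta> y a"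
      "\<And>x a b. \<lbrakk>x \<in> N; a \<in> carrier A; b \<in> carrier A\<rbrakk> \<Longrightarrow> \<beta> x (a \<oplus>\<^bsub>A\<^esub> b) = \<beta> x a \<otimes>\<^bsub>rat_mod_int\<^esub> \<beta> x b"
      "\<And>r x a. \<lbrakk>r \<in> carrier R; x \<in> N; a \<in> carrier A\<rbrakk> \<Longrightarrow> \<beta> (r \<odot>\<^bsub>M\<^esub> x) a = \<beta> x (r \<odot>\<^bsub>A\<^esub> a)"
      by (auto simp: balanced_map_def)
    \<comment> \<open>For each \<open>a\<close> separately the character \<open>\<beta> _ a\<close>
      of \<open>N\<close> is extended to \<open>M\<close>. The resulting \<open>\<psi>\<close> is an
      uncoordinated choice; the equations for sums and multiples hold on \<open>N\<close> only,
      which suffices after applying \<open>\<kappa>\<close>.\<close>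
    have "\<exists>\<phi>. \<phi> \<in> carrier ?L \<and> (\<forall>x \<in> N. \<phi> x = \<beta> x a)" if "a \<in> carrier A" for a
      by (rule character_extend[OF M N, of "\<lambda>x. \<beta> x a"]) (use \<beta>(1,2) that in auto)
    then obtain \<psi> where \<psi>: "\<And>a. a \<in> carrier A \<Longrightarrow> \<psi> a \<in> carrier ?L"
      and \<psi>\<beta>: "\<And>a x. \<lbrakk>a \<in> carrier A; x \<in> N\<rbrakk> \<Longrightarrow> \<psi> a x = \<beta> x a"
      by metis
    note \<sigma> = \<kappa>D(1)[OF \<psi>]
    have add: "\<kappa> (\<psi> (a \<oplus>\<^bsub>A\<^esub> b)) = \<kappa> (\<psi> a) \<oplus>\<^bsub>?L\<^esub> \<kappa> (\<psi> b)" if ab: "a \<in> carrier A" "b \<in> carrier A" for a b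
    proof -
      have "\<kappa> (\<psi> (a \<oplus>\<^bsub>A\<^esub> b)) = \<kappa> (\<psi> a \<oplus>\<^bsub>?L\<^esub> \<psi> b)"
        using ab L.a_closed[OF \<psi>[OF ab(1)] \<psi>[OF ab(2)]]
        by (intro \<kappa>_cong \<psi>) (auto simp: \<psi>\<beta> \<beta>(3) Nc)
      then show ?thesis using \<kappa>D(2)[OF \<psi>[OF ab(1)] \<psi>[OF ab(2)]] by (simp del: character_module_simps)
    qed
    have smult: "\<kappa> (\<psi> (r \<odot>\<^bsub>A\<^esub> a)) = r \<odot>\<^bsub>?L\<^esub> \<kappa> (\<psi> a)" if ra: "r \<in> carrier R" "a \<in> carrier A" for r a
    proof -
      have "\<kappa> (\<psi> (r \<odot>\<^bsub>A\<^esub> a)) = \<kappa> (r \<odot>\<^bsub>?L\<^esub> \<psi> a)"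
        using ra L.smult_closed[OF ra(1) \<psi>[OF ra(2)]]
        by (intro \<kappa>_cong \<psi>) (auto simp: \<psi>\<beta> \<beta>(4) Nc A.smult_closed)
      then show ?thesis using \<kappa>D(3)[OF ra(1) \<psi>[OF ra(2)]] by (simp del: character_module_simps)
    qed
    have "balanced_map R M A (\<lambda>x a. \<kappa> (\<psi> a) x)"
      unfolding balanced_map_def
      by (simp add: character_moduleD(1,2)[OF \<sigma>] add smult)
    moreover have "\<kappa> (\<psi> a) x = \<beta> x a" if "x \<in> N" "a \<in> carrier A" for x a
      using \<kappa>_N[OF \<psi>[OF that(2)] that(1)] \<psi>\<beta>[OF that(2,1)] by simp
    ultimately show "\<exists>\<beta>'. balanced_map R M A \<beta>' \<and>
      (\<forall>x \<in> carrier (M\<lparr>carrier := N\<rparr>). \<forall>a \<in> carrier A. \<beta>' x a = \<beta> x a)"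
      by (intro exI[of _ "\<lambda>x a. \<kappa> (\<psi> a) x"]) simp
  qed
qed

section \<open>The trace\<close>

lemma module_hom_into_submodule:
  assumes "submodule Y R M'" "f \<in> module_hom R M (M'\<lparr>carrier := Y\<rparr>)"
  shows "f \<in> module_hom R M M'" and "\<And>x. x \<in> carrier M \<Longrightarrow> f x \<in> Y"
    and "\<And>x. x \<in> carrier M \<Longrightarrow> f x \<in> carrier M'"
proof -
  interpret submodule Y R M' by fact
  show fY: "f x \<in> Y" if "x \<in> carrier M" for x
    using module_homD(1)[OF assms(2) that] by simp
  show fM': "f x \<in> carrier M'" if "x \<in> carrier M" for x
    using subsetD[OF subset fY[OF that]] by simp
  show "f \<in> module_hom R M M'"
    using module_homD(2,3)[OF assms(2)] fM' by (intro module_homI) auto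
qed

text \<open>Makes the family of endomorphisms given to the Baer property non-empty.\<close>

lemma zero_module_hom:
  assumes M: "right_module R M" and Y: "submodule Y R M"
  shows "(\<lambda>x. \<zero>\<^bsub>M\<^esub>) \<in> module_hom R M (M\<lparr>carrier := Y\<rparr>)"
proof (rule module_homI)
  interpret M: right_module R M by fact
  interpret Y: submodule Y R M by fact
  show "\<zero>\<^bsub>M\<^esub> \<in> carrier (M\<lparr>carrier := Y\<rparr>)" using Y.one_closed by simp
  show "\<zero>\<^bsub>M\<^esub> = \<zero>\<^bsub>M\<^esub> \<oplus>\<^bsub>M\<lparr>carrier := Y\<rparr>\<^esub> \<zero>\<^bsub>M\<^esub>" by simp
  show "\<zero>\<^bsub>M\<^esub> = r \<odot>\<^bsub>M\<lparr>carrier := Y\<rparr>\<^esub> \<zero>\<^bsub>M\<^esub>" if "r \<in> carrier R" for r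
    using group_hom.hom_one[OF M.smult_group_hom[OF that]] by simp
qed

text \<open>The trace is generated inside \<open>Y\<close>; as the generators lie in
  \<open>Y\<close>, generating inside \<open>M\<close> gives the same subgroup, and characters of
  \<open>M\<close> can be tested on it.\<close>

lemma module_trace_eq:
  assumes M: "right_module R M" and Y: "submodule Y R M"
  shows "module_trace R M (M\<lparr>carrier := Y\<rparr>) =
    generate (add_monoid M) (\<Union>f \<in> module_hom R M (M\<lparr>carrier := Y\<rparr>). f ` carrier M)"
proof -
  interpret M: right_module R M by fact
  interpret Y: submodule Y R M by fact
  have "(\<Union>f \<in> module_hom R M (M\<lparr>carrier := Y\<rparr>). f ` carrier M) \<subseteq> Y"
    by (auto intro: module_hom_into_submodule(2)[OF Y])
  then show ?thesis
    unfolding module_trace_def add_monoid_carrier_update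
    by (rule group.generate_consistent[OF M.a_group _ Y.subgroup_axioms])
qed

text \<open>Multiplication by \<open>r\<close> is an additive endomorphism mapping the generating
  set into itself, because the homomorphisms are linear; it therefore preserves the generated
  subgroup.\<close>

lemma submodule_module_trace:
  assumes M: "right_module R M" and Y: "submodule Y R M"
  shows "submodule (module_trace R M (M\<lparr>carrier := Y\<rparr>)) R M"
proof -
  interpret M: right_module R M by fact
  let ?X = "\<Union>f \<in> module_hom R M (M\<lparr>carrier := Y\<rparr>). f ` carrier M"
  have X: "?X \<subseteq> carrier (add_monoid M)"
    by (auto intro: module_hom_into_submodule(3)[OF Y])
  have "r \<odot>\<^bsub>M\<^esub> t \<in> generate (add_monoid M) ?X" if r: "r \<in> carrier R" and t: "t \<in> generate (add_monoid M) ?X" for r t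
  proof -
    interpret r: group_hom "add_monoid M" "add_monoid M" "\<lambda>x. r \<odot>\<^bsub>M\<^esub> x"
      by (rule M.smult_group_hom[OF r])
    have "r \<odot>\<^bsub>M\<^esub> f x \<in> ?X" if f: "f \<in> module_hom R M (M\<lparr>carrier := Y\<rparr>)" and x: "x \<in> carrier M" for f x
    proof -
      have "r \<odot>\<^bsub>M\<^esub> f x = f (r \<odot>\<^bsub>M\<^esub> x)" using module_homD(3)[OF f r x] by simp
      then show ?thesis using f M.smult_closed[OF r x] by blast
    qed
    then have "(\<lambda>x. r \<odot>\<^bsub>M\<^esub> x) ` ?X \<subseteq> ?X" by blast
    then have "generate (add_monoid M) ((\<lambda>x. r \<odot>\<^bsub>M\<^esub> x) ` ?X) \<subseteq> generate (add_monoid M) ?X"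
      by (rule group.mono_generate[OF M.a_group])
    then show ?thesis using r.generate_img[OF X] t by auto
  qed
  with group.generate_is_subgroup[OF M.a_group X] show ?thesis
    unfolding module_trace_eq[OF M Y] by (intro submodule.intro submodule_axioms.intro)
qed

lemma annihilator_module_trace:
  assumes M: "right_module R M" and Y: "submodule Y R M"
  shows "annihilator M (module_trace R M (M\<lparr>carrier := Y\<rparr>)) =
    (\<Inter>F \<in> (\<lambda>f \<phi>. \<lambda>x \<in> carrier M. \<phi> (f x)) ` module_hom R M (M\<lparr>carrier := Y\<rparr>).
      a_kernel (character_module M) (character_module M) F)"
proof -
  interpret M: right_module R M by fact
  let ?L = "character_module M"
  let ?H = "module_hom R M (M\<lparr>carrier := Y\<rparr>)"
  let ?X = "\<Union>f \<in> ?H. f ` carrier M"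
  have "annihilator M (module_trace R M (M\<lparr>carrier := Y\<rparr>)) =
    {\<phi> \<in> carrier ?L. \<forall>x \<in> ?X. \<phi> x = \<one>\<^bsub>rat_mod_int\<^esub>}"
  proof -
    have "(\<forall>x \<in> generate (add_monoid M) ?X. \<phi> x = \<one>\<^bsub>rat_mod_int\<^esub>) \<longleftrightarrow>
      (\<forall>x \<in> ?X. \<phi> x = \<one>\<^bsub>rat_mod_int\<^esub>)" if \<phi>: "\<phi> \<in> carrier ?L" for \<phi>
    proof
      interpret \<phi>: group_hom "add_monoid M" rat_mod_int \<phi>
        using \<phi> by (simp add: group_hom_def group_hom_axioms_def QZ.is_group M.a_group character_module_def)
      assume *: "\<forall>x \<in> ?X. \<phi> x = \<one>\<^bsub>rat_mod_int\<^esub>"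
      have "?X \<subseteq> kernel (add_monoid M) rat_mod_int \<phi>"
      proof
        fix x assume x: "x \<in> ?X"
        then have "x \<in> carrier M" by (auto intro: module_hom_into_submodule(3)[OF Y])
        moreover have "\<phi> x = \<one>\<^bsub>rat_mod_int\<^esub>" using * x by (rule bspec)
        ultimately show "x \<in> kernel (add_monoid M) rat_mod_int \<phi>" by (simp add: kernel_def)
      qed
      then have "generate (add_monoid M) ?X \<subseteq> kernel (add_monoid M) rat_mod_int \<phi>"
        by (rule group.generate_subgroup_incl[OF M.a_group _ \<phi>.subgroup_kernel])
      then show "\<forall>x \<in> generate (add_monoid M) ?X. \<phi> x = \<one>\<^bsub>rat_mod_int\<^esub>"
        by (auto simp: kernel_def)
    qed (simp add: generate.incl)
    then show ?thesis unfolding annihilator_def module_trace_eq[OF M Y] by blast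
  qed
  also have "\<dots> = (\<Inter>F \<in> (\<lambda>f \<phi>. \<lambda>x \<in> carrier M. \<phi> (f x)) ` ?H. a_kernel ?L ?L F)"
  proof -
    have "\<phi> \<in> a_kernel ?L ?L (\<lambda>\<phi>. \<lambda>x \<in> carrier M. \<phi> (f x)) \<longleftrightarrow>
      \<phi> \<in> carrier ?L \<and> (\<forall>x \<in> carrier M. \<phi> (f x) = \<one>\<^bsub>rat_mod_int\<^esub>)" for f \<phi>
      by (auto simp: a_kernel_def kernel_def fun_eq_iff restrict_def)
    \<comment> \<open>With an empty index set the intersection would be the whole type; the zero
      homomorphism confines it to the carrier.\<close>
    then show ?thesis using zero_module_hom[OF M Y] by auto
  qed
  finally show ?thesis .
qed

lemma precomposition_module_hom:
  assumes M: "right_module R M" and f: "f \<in> module_hom R M M"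
  shows "(\<lambda>\<phi>. \<lambda>x \<in> carrier M. \<phi> (f x)) \<in> module_hom R (character_module M) (character_module M)"
proof (rule module_homI)
  interpret M: right_module R M by fact
  note fD = module_homD[OF f]
  show "(\<lambda>x \<in> carrier M. \<phi> (f x)) \<in> carrier (character_module M)" if "\<phi> \<in> carrier (character_module M)" for \<phi>
    by (intro character_moduleI) (auto simp: fD character_moduleD(1,2)[OF that])
qed (auto intro!: restrict_ext simp: module_homD[OF f] right_module.smult_closed[OF M])

lemma Baer_annihilator_trace_summand:
  assumes M: "right_module R M" and Y: "submodule Y R M"
    and Baer: "Baer_module R (character_module M)"
  shows "direct_summand R (character_module M) (annihilator M (module_trace R M (M\<lparr>carrier := Y\<rparr>)))"
proof -
  let ?H = "module_hom R M (M\<lparr>carrier := Y\<rparr>)"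
  let ?S = "(\<lambda>f \<phi>. \<lambda>x \<in> carrier M. \<phi> (f x)) ` ?H"
  have "?S \<noteq> {}" using zero_module_hom[OF M Y] by blast
  moreover have "?S \<subseteq> module_hom R (character_module M) (character_module M)"
    by (auto intro: precomposition_module_hom[OF M module_hom_into_submodule(1)[OF Y]])
  ultimately show ?thesis
    using Baer[unfolded Baer_module_def, rule_format, of ?S]
    unfolding annihilator_module_trace[OF M Y] by simp
qed

text \<open>The trace always lies in \<open>N\<close>. Conversely, restricting the given surjection
  to one summand is a homomorphism from \<open>M\<close> to \<open>N\<close>, and every element of
  the direct sum is a finite sum of elements from single summands.\<close>

lemma module_trace_eq_if_Gen:
  fixes R :: "('r, 'k) ring_scheme" and M :: "('r, 'a, 'm) module_scheme"
  assumes M: "right_module R M" and N: "submodule N R M"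
    and gen: "Gen TYPE('i) R M (M\<lparr>carrier := N\<rparr>)"
  shows "module_trace R M (M\<lparr>carrier := N\<rparr>) = N"
proof (intro equalityI subsetI)
  interpret M: right_module R M by fact
  interpret N: submodule N R M by fact
  let ?T = "module_trace R M (M\<lparr>carrier := N\<rparr>)"
  interpret T: submodule ?T R M by (rule submodule_module_trace[OF M N])
  show "x \<in> N" if x: "x \<in> ?T" for x
  proof -
    have "generate (add_monoid M) (\<Union>f \<in> module_hom R M (M\<lparr>carrier := N\<rparr>). f ` carrier M) \<subseteq> N"
      by (rule group.generate_subgroup_incl[OF M.a_group _ N.subgroup_axioms])
        (auto intro: module_hom_into_submodule(2)[OF N])
    then show ?thesis using x unfolding module_trace_eq[OF M N] by blast
  qed
  obtain I :: "'i set" and h where h: "h \<in> module_hom R (direct_sum_copies I M) (M\<lparr>carrier := N\<rparr>)"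
    and surj: "h ` carrier (direct_sum_copies I M) = N"
    using gen by (auto simp: Gen_def)
  let ?S = "direct_sum_copies I M"
  note hD = module_homD[OF h]
  have carr: "v \<in> carrier ?S \<longleftrightarrow> v \<in> I \<rightarrow>\<^sub>E carrier M \<and> finite {i \<in> I. v i \<noteq> \<zero>\<^bsub>M\<^esub>}" for v
    by (simp add: direct_sum_copies_def)
  have add: "v \<oplus>\<^bsub>?S\<^esub> w = (\<lambda>i \<in> I. v i \<oplus>\<^bsub>M\<^esub> w i)" for v w by (simp add: direct_sum_copies_def)
  have smult: "r \<odot>\<^bsub>?S\<^esub> v = (\<lambda>i \<in> I. r \<odot>\<^bsub>M\<^esub> v i)" for r v by (simp add: direct_sum_copies_def)
  define \<iota> where "\<iota> j m = (\<lambda>i \<in> I. if i = j then m else \<zero>\<^bsub>M\<^esub>)" for j m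
  have \<iota>: "\<iota> j m \<in> carrier ?S" if "m \<in> carrier M" for j m
    unfolding carr using that
    by (auto simp: \<iota>_def intro!: finite_subset[of _ "{j}"])
  have h\<iota>: "(\<lambda>m. h (\<iota> j m)) \<in> module_hom R M (M\<lparr>carrier := N\<rparr>)" for j
  proof (rule module_homI)
    show "h (\<iota> j m) \<in> carrier (M\<lparr>carrier := N\<rparr>)" if "m \<in> carrier M" for m
      by (rule hD(1)[OF \<iota>[OF that]])
    show "h (\<iota> j (m \<oplus>\<^bsub>M\<^esub> m')) = h (\<iota> j m) \<oplus>\<^bsub>M\<lparr>carrier := N\<rparr>\<^esub> h (\<iota> j m')"
      if "m \<in> carrier M" "m' \<in> carrier M" for m m'
    proof -
      have "\<iota> j (m \<oplus>\<^bsub>M\<^esub> m') = \<iota> j m \<oplus>\<^bsub>?S\<^esub> \<iota> j m'"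
        unfolding add \<iota>_def by (auto intro!: restrict_ext)
      then show ?thesis using hD(2)[OF \<iota>[OF that(1)] \<iota>[OF that(2)]] by simp
    qed
    show "h (\<iota> j (r \<odot>\<^bsub>M\<^esub> m)) = r \<odot>\<^bsub>M\<lparr>carrier := N\<rparr>\<^esub> h (\<iota> j m)"
      if r: "r \<in> carrier R" and m: "m \<in> carrier M" for r m
    proof -
      have "r \<odot>\<^bsub>M\<^esub> \<zero>\<^bsub>M\<^esub> = \<zero>\<^bsub>M\<^esub>"
        using group_hom.hom_one[OF M.smult_group_hom[OF r]] by simp
      then have "\<iota> j (r \<odot>\<^bsub>M\<^esub> m) = r \<odot>\<^bsub>?S\<^esub> \<iota> j m"
        unfolding smult \<iota>_def by (auto intro!: restrict_ext)
      then show ?thesis using hD(3)[OF r \<iota>[OF m]] by simp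
    qed
  qed
  have h\<iota>_trace: "h (\<iota> j m) \<in> ?T" if "m \<in> carrier M" for j m
    unfolding module_trace_eq[OF M N] using h\<iota>[of j] that by (intro generate.incl) blast
  \<comment> \<open>The induction is over a finite set containing the support, which need not equal
    it, so removing one coordinate of \<open>v\<close> leaves a vector to which the hypothesis
    applies.\<close>
  have "h v \<in> ?T" if "finite F" "v \<in> carrier ?S" "{i \<in> I. v i \<noteq> \<zero>\<^bsub>M\<^esub>} \<subseteq> F" for F v
    using that
  proof (induction F arbitrary: v rule: finite_induct)
    case empty
    \<comment> \<open>The zero vector is written as an embedded zero, at an arbitrary index, so that
      \<open>h\<iota>_trace\<close> covers it as well.\<close>
    then have "v = \<iota> undefined \<zero>\<^bsub>M\<^esub>"
      unfolding carr \<iota>_def by (intro extensionalityI[of _ I]) (auto simp: PiE_def)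
    then show ?case using h\<iota>_trace by simp
  next
    case (insert j F)
    have vc: "v i \<in> carrier M" if "i \<in> I" for i using insert.prems(1) that by (auto simp: carr)
    show ?case
    proof (cases "j \<in> I")
      case False
      then show ?thesis using insert.prems by (intro insert.IH) auto
    next
      case True
      define w where "w = (\<lambda>i \<in> I. if i = j then \<zero>\<^bsub>M\<^esub> else v i)"
      have "finite {i \<in> I. w i \<noteq> \<zero>\<^bsub>M\<^esub>}"
        using insert.prems(1) unfolding carr
        by (auto simp: w_def elim!: finite_subset[rotated])
      then have w: "w \<in> carrier ?S" unfolding carr using vc by (auto simp: w_def)
      have "h w \<in> ?T"
        using insert.prems(2) by (intro insert.IH[OF w]) (auto simp: w_def)
      moreover have "v = \<iota> j (v j) \<oplus>\<^bsub>?S\<^esub> w"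
        using insert.prems(1) vc True unfolding carr add
        by (intro extensionalityI[of _ I]) (auto simp: PiE_def w_def \<iota>_def)
      then have "h v = h (\<iota> j (v j)) \<oplus>\<^bsub>M\<^esub> h w"
        using hD(2)[OF \<iota>[OF vc[OF True], of j] w] by simp
      ultimately show ?thesis
        using T.m_closed[OF h\<iota>_trace[OF vc[OF True], of j]] by simp
    qed
  qed
  then show "x \<in> ?T" if "x \<in> N" for x
    using that carr unfolding surj[symmetric] by blast
qed

section \<open>Flatness of quotients\<close>

text \<open>All operations, including zero, are put in terms of cosets of representatives, which
  reduces the module laws to those of \<open>M\<close>. In the scalar clause the summand
  \<open>N\<close> fills up the image of a coset, which may be a proper part of a coset; that
  nothing more is added rests on \<open>N\<close> being closed under scalars.\<close>

lemma quotient_module_simps: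
  assumes M: "right_module R M" and N: "submodule N R M"
  shows "carrier (quotient_module R M N) = (\<lambda>x. N +>\<^bsub>M\<^esub> x) ` carrier M"
    and "\<zero>\<^bsub>quotient_module R M N\<^esub> = N +>\<^bsub>M\<^esub> \<zero>\<^bsub>M\<^esub>"
    and "\<And>x y. \<lbrakk>x \<in> carrier M; y \<in> carrier M\<rbrakk> \<Longrightarrow>
      (N +>\<^bsub>M\<^esub> x) \<oplus>\<^bsub>quotient_module R M N\<^esub> (N +>\<^bsub>M\<^esub> y) = N +>\<^bsub>M\<^esub> (x \<oplus>\<^bsub>M\<^esub> y)"
    and "\<And>r x. \<lbrakk>r \<in> carrier R; x \<in> carrier M\<rbrakk> \<Longrightarrow>
      r \<odot>\<^bsub>quotient_module R M N\<^esub> (N +>\<^bsub>M\<^esub> x) = N +>\<^bsub>M\<^esub> (r \<odot>\<^bsub>M\<^esub> x)"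
proof -
  interpret M: right_module R M by fact
  interpret N: submodule N R M by fact
  interpret AN: abelian_subgroup N M
    by (rule abelian_subgroupI2[OF M.a_comm_group N.subgroup_axioms])
  show "carrier (quotient_module R M N) = (\<lambda>x. N +>\<^bsub>M\<^esub> x) ` carrier M"
    by (auto simp: quotient_module_def A_RCOSETS_def')
  show "\<zero>\<^bsub>quotient_module R M N\<^esub> = N +>\<^bsub>M\<^esub> \<zero>\<^bsub>M\<^esub>"
    using AN.a_subset by (simp add: quotient_module_def)
  show "(N +>\<^bsub>M\<^esub> x) \<oplus>\<^bsub>quotient_module R M N\<^esub> (N +>\<^bsub>M\<^esub> y) = N +>\<^bsub>M\<^esub> (x \<oplus>\<^bsub>M\<^esub> y)"
    if "x \<in> carrier M" "y \<in> carrier M" for x y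
    using AN.a_rcos_sum[OF that] by (simp add: quotient_module_def)
  show "r \<odot>\<^bsub>quotient_module R M N\<^esub> (N +>\<^bsub>M\<^esub> x) = N +>\<^bsub>M\<^esub> (r \<odot>\<^bsub>M\<^esub> x)"
    if r: "r \<in> carrier R" and x: "x \<in> carrier M" for r x
  proof -
    have Nc: "n \<in> carrier M" if "n \<in> N" for n using that AN.a_subset by auto
    have "N <+>\<^bsub>M\<^esub> ((\<odot>\<^bsub>M\<^esub>) r ` (N +>\<^bsub>M\<^esub> x)) = N +>\<^bsub>M\<^esub> (r \<odot>\<^bsub>M\<^esub> x)"
    proof (intro equalityI subsetI)
      fix z assume "z \<in> N <+>\<^bsub>M\<^esub> ((\<odot>\<^bsub>M\<^esub>) r ` (N +>\<^bsub>M\<^esub> x))"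
      then obtain n n' where n: "n \<in> N" "n' \<in> N" "z = n \<oplus>\<^bsub>M\<^esub> r \<odot>\<^bsub>M\<^esub> (n' \<oplus>\<^bsub>M\<^esub> x)"
        by (auto simp: set_add_def' a_r_coset_def')
      then have "z = (n \<oplus>\<^bsub>M\<^esub> r \<odot>\<^bsub>M\<^esub> n') \<oplus>\<^bsub>M\<^esub> r \<odot>\<^bsub>M\<^esub> x"
        using r x Nc by (simp add: M.smult_r_distr M.a_assoc M.smult_closed)
      moreover have "n \<oplus>\<^bsub>M\<^esub> r \<odot>\<^bsub>M\<^esub> n' \<in> N" using n r by simp
      ultimately show "z \<in> N +>\<^bsub>M\<^esub> (r \<odot>\<^bsub>M\<^esub> x)" by (auto simp: a_r_coset_def')
    next
      fix z assume "z \<in> N +>\<^bsub>M\<^esub> (r \<odot>\<^bsub>M\<^esub> x)"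
      then obtain n where n: "n \<in> N" "z = n \<oplus>\<^bsub>M\<^esub> r \<odot>\<^bsub>M\<^esub> x"
        by (auto simp: a_r_coset_def')
      moreover have "x \<in> N +>\<^bsub>M\<^esub> x" using AN.a_rcos_self[OF x] .
      ultimately show "z \<in> N <+>\<^bsub>M\<^esub> ((\<odot>\<^bsub>M\<^esub>) r ` (N +>\<^bsub>M\<^esub> x))"
        unfolding set_add_def' by blast
    qed
    then show ?thesis by (simp add: quotient_module_def)
  qed
qed

lemma right_module_quotient_module:
  assumes M: "right_module R M" and N: "submodule N R M"
  shows "right_module R (quotient_module R M N)"
proof -
  interpret M: right_module R M by fact
  note Q = quotient_module_simps[OF M N]
  have "abelian_group (quotient_module R M N)"
  proof (rule abelian_groupI)
    fix C assume "C \<in> carrier (quotient_module R M N)"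
    then obtain x where x: "x \<in> carrier M" "C = N +>\<^bsub>M\<^esub> x" unfolding Q(1) by blast
    then show "\<exists>D\<in>carrier (quotient_module R M N).
        D \<oplus>\<^bsub>quotient_module R M N\<^esub> C = \<zero>\<^bsub>quotient_module R M N\<^esub>"
      by (intro bexI[of _ "N +>\<^bsub>M\<^esub> (\<ominus>\<^bsub>M\<^esub> x)"]) (auto simp: Q M.l_neg)
  qed (auto simp: Q M.a_ac)
  then show ?thesis
    by (intro right_module.intro right_module_axioms.intro M.ring_axioms)
      (auto simp: Q M.smult_closed M.smult_l_distr M.smult_r_distr M.smult_assoc M.smult_one)
qed

text \<open>
  The annihilator of \<open>N\<close> is the character module of \<open>M/N\<close>, so that projecting to it turns characters
  of \<open>M\<close> into characters of \<open>M/N\<close>.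
\<close>

lemma flat_quotient_if_annihilator_summand:
  fixes R :: "('r, 'k) ring_scheme" and M :: "('r, 'a, 'm) module_scheme"
  assumes flat: "flat_module TYPE('u) R M" and N: "submodule N R M"
    and sum: "direct_summand R (character_module M) (annihilator M N)"
  shows "flat_module TYPE('u) R (quotient_module R M N)"
  unfolding flat_module_def
proof (intro conjI allI impI)
  have M: "right_module R M" using flat by (simp add: flat_module_def)
  let ?L = "character_module M" and ?Q = "quotient_module R M N"
  interpret M: right_module R M by fact
  interpret N: submodule N R M by fact
  interpret AN: abelian_subgroup N M
    by (rule abelian_subgroupI2[OF M.a_comm_group N.subgroup_axioms])
  interpret L: left_module R ?L by (rule left_module_character_module[OF M])
  note Q = quotient_module_simps[OF M N]
  show Qm: "right_module R ?Q" by (rule right_module_quotient_module[OF M N])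
  fix A B :: "('r, 'u) module" and g
  assume "left_module R A \<and> left_module R B \<and> g \<in> module_hom R A B \<and> inj_on g (carrier A)"
  then have A: "left_module R A" and B: "left_module R B" and g: "g \<in> module_hom R A B"
    and inj: "inj_on g (carrier A)" by auto
  interpret A: left_module R A by fact
  interpret B: left_module R B by fact
  interpret Q: right_module R ?Q by fact
  interpret tM: tensor_of_homs R M M A B "\<lambda>x. x" g
    by unfold_locales (auto intro!: module_homI g)
  interpret tQ: tensor_of_homs R ?Q ?Q A B "\<lambda>x. x" g
    by unfold_locales (auto intro!: module_homI g)
  have Nc: "x \<in> carrier M" if "x \<in> N" for x using that AN.a_subset by auto
  have injM: "inj_on (tensor_map R M B (\<lambda>x. x) g) (carrier (tensor_product R M A))"
    using flat A B g inj by (simp add: flat_module_def)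
  obtain \<pi> where \<pi>: "\<pi> \<in> module_hom R ?L ?L"
    and \<pi>N: "\<And>\<phi>. \<phi> \<in> carrier ?L \<Longrightarrow> \<pi> \<phi> \<in> annihilator M N"
    and \<pi>_id: "\<And>\<phi>. \<phi> \<in> annihilator M N \<Longrightarrow> \<pi> \<phi> = \<phi>"
    by (rule direct_summand_projections[OF L.left_module_axioms sum]) blast
  note \<pi>D = module_homD[OF \<pi>]
  show "inj_on (tensor_map R ?Q B (\<lambda>x. x) g) (carrier (tensor_product R ?Q A))"
  proof (rule tQ.tensor_map_inj_onI)
    fix \<beta> assume "balanced_map R ?Q A \<beta>"
    then have \<beta>: "\<And>C a. \<lbrakk>C \<in> carrier ?Q; a \<in> carrier A\<rbrakk> \<Longrightarrow> \<beta> C a \<in> carrier rat_mod_int"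
      "\<And>C D a. \<lbrakk>C \<in> carrier ?Q; D \<in> carrier ?Q; a \<in> carrier A\<rbrakk> \<Longrightarrow>
        \<beta> (C \<oplus>\<^bsub>?Q\<^esub> D) a = \<beta> C a \<otimes>\<^bsub>rat_mod_int\<^esub> \<beta> D a"
      "\<And>C a b. \<lbrakk>C \<in> carrier ?Q; a \<in> carrier A; b \<in> carrier A\<rbrakk> \<Longrightarrow>
        \<beta> C (a \<oplus>\<^bsub>A\<^esub> b) = \<beta> C a \<otimes>\<^bsub>rat_mod_int\<^esub> \<beta> C b"
      "\<And>r C a. \<lbrakk>r \<in> carrier R; C \<in> carrier ?Q; a \<in> carrier A\<rbrakk> \<Longrightarrow>
        \<beta> (r \<odot>\<^bsub>?Q\<^esub> C) a = \<beta> C (r \<odot>\<^bsub>A\<^esub> a)"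
      by (auto simp: balanced_map_def)
    have q: "N +>\<^bsub>M\<^esub> x \<in> carrier ?Q" if "x \<in> carrier M" for x using that by (simp add: Q(1))
    \<comment> \<open>Pulled back along the projection from \<open>M\<close>, the map extends from
      \<open>A\<close> to \<open>B\<close> by flatness of \<open>M\<close>. The extension
      \<open>\<gamma>\<close> need not be trivial on \<open>N\<close> at elements outside the image
      of \<open>g\<close>.\<close>
    have "balanced_map R M A (\<lambda>x a. \<beta> (N +>\<^bsub>M\<^esub> x) a)"
      unfolding balanced_map_def
      by (simp add: \<beta> q Q(3,4)[symmetric])
    then obtain \<gamma> where "balanced_map R M B \<gamma>"
      and \<gamma>\<beta>: "\<And>x a. \<lbrakk>x \<in> carrier M; a \<in> carrier A\<rbrakk> \<Longrightarrow> \<gamma> x (g a) = \<beta> (N +>\<^bsub>M\<^esub> x) a"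
      by (rule tM.balanced_map_extend[OF injM]) blast
    then have \<gamma>: "\<And>x a. \<lbrakk>x \<in> carrier M; a \<in> carrier B\<rbrakk> \<Longrightarrow> \<gamma> x a \<in> carrier rat_mod_int"
      "\<And>x y a. \<lbrakk>x \<in> carrier M; y \<in> carrier M; a \<in> carrier B\<rbrakk> \<Longrightarrow>
        \<gamma> (x \<oplus>\<^bsub>M\<^esub> y) a = \<gamma> x a \<otimes>\<^bsub>rat_mod_int\<^esub> \<gamma> y a"
      "\<And>x a b. \<lbrakk>x \<in> carrier M; a \<in> carrier B; b \<in> carrier B\<rbrakk> \<Longrightarrow>
        \<gamma> x (a \<oplus>\<^bsub>B\<^esub> b) = \<gamma> x a \<otimes>\<^bsub>rat_mod_int\<^esub> \<gamma> x b"
      "\<And>r x a. \<lbrakk>r \<in> carrier R; x \<in> carrier M; a \<in> carrier B\<rbrakk> \<Longrightarrow> \<gamma> (r \<odot>\<^bsub>M\<^esub> x) a = \<gamma> x (r \<odot>\<^bsub>B\<^esub> a)"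
      by (auto simp: balanced_map_def)
    \<comment> \<open>The curried form of \<open>\<gamma>\<close>, linear in \<open>b\<close>.
      Projecting its values into the annihilator makes them constant on cosets of
      \<open>N\<close>.\<close>
    define \<psi> where "\<psi> b = (\<lambda>x \<in> carrier M. \<gamma> x b)" for b
    have \<psi>: "\<psi> b \<in> carrier ?L" if "b \<in> carrier B" for b
      using that by (intro character_moduleI) (auto simp: \<psi>_def \<gamma>)
    have \<psi>_add: "\<psi> (a \<oplus>\<^bsub>B\<^esub> b) = \<psi> a \<oplus>\<^bsub>?L\<^esub> \<psi> b" if "a \<in> carrier B" "b \<in> carrier B" for a b
      using that by (auto intro!: restrict_ext simp: \<psi>_def \<gamma>)
    have \<psi>_smult: "\<psi> (r \<odot>\<^bsub>B\<^esub> b) = r \<odot>\<^bsub>?L\<^esub> \<psi> b" if "r \<in> carrier R" "b \<in> carrier B" for r b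
      using that by (auto intro!: restrict_ext simp: \<psi>_def \<gamma> M.smult_closed)
    note \<rho> = \<pi>D(1)[OF \<psi>]
    have \<rho>_add: "\<pi> (\<psi> (a \<oplus>\<^bsub>B\<^esub> b)) = \<pi> (\<psi> a) \<oplus>\<^bsub>?L\<^esub> \<pi> (\<psi> b)" if "a \<in> carrier B" "b \<in> carrier B" for a b
      using \<pi>D(2)[OF \<psi>[OF that(1)] \<psi>[OF that(2)]] \<psi>_add[OF that] by (simp del: character_module_simps)
    have \<rho>_smult: "\<pi> (\<psi> (r \<odot>\<^bsub>B\<^esub> b)) = r \<odot>\<^bsub>?L\<^esub> \<pi> (\<psi> b)" if "r \<in> carrier R" "b \<in> carrier B" for r b
      using \<pi>D(3)[OF that(1) \<psi>[OF that(2)]] \<psi>_smult[OF that] by (simp del: character_module_simps)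
    have \<rho>_coset: "\<pi> (\<psi> b) x = \<pi> (\<psi> b) y"
      if b: "b \<in> carrier B" and x: "x \<in> carrier M" and y: "y \<in> carrier M" and eq: "N +>\<^bsub>M\<^esub> x = N +>\<^bsub>M\<^esub> y" for b x y
    proof -
      have "x \<in> N +>\<^bsub>M\<^esub> y" using AN.a_rcos_self[OF x] eq by simp
      then obtain n where n: "n \<in> N" "x = n \<oplus>\<^bsub>M\<^esub> y" by (auto simp: a_r_coset_def')
      then have "\<pi> (\<psi> b) n = \<one>\<^bsub>rat_mod_int\<^esub>"
        using \<pi>N[OF \<psi>[OF b]] by (simp add: annihilator_def)
      then show ?thesis
        using n y Nc character_moduleD(1,2)[OF \<rho>[OF b]] by simp
    qed
    \<comment> \<open>Any representative of the coset gives the same value, by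
      \<open>\<rho>_coset\<close>.\<close>
    define \<beta>' where "\<beta>' C b = \<pi> (\<psi> b) (SOME x. x \<in> carrier M \<and> N +>\<^bsub>M\<^esub> x = C)" for C b
    have \<beta>': "\<beta>' (N +>\<^bsub>M\<^esub> x) b = \<pi> (\<psi> b) x" if x: "x \<in> carrier M" and b: "b \<in> carrier B" for x b
    proof -
      have "\<exists>y. y \<in> carrier M \<and> N +>\<^bsub>M\<^esub> y = N +>\<^bsub>M\<^esub> x" using x by blast
      from someI_ex[OF this] show ?thesis unfolding \<beta>'_def using \<rho>_coset[OF b _ x] by blast
    qed
    have "balanced_map R ?Q B \<beta>'"
      unfolding balanced_map_def Q(1)
      by (auto simp: Q(3,4) \<beta>' \<rho>_add \<rho>_smult character_moduleD(1,2)[OF \<rho>] M.smult_closed B.smult_closed)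
    moreover have "\<beta>' C (g a) = \<beta> C a" if C: "C \<in> carrier ?Q" and a: "a \<in> carrier A" for C a
    proof -
      obtain x where x: "x \<in> carrier M" "C = N +>\<^bsub>M\<^esub> x" using C unfolding Q(1) by blast
      have ga: "g a \<in> carrier B" using module_homD(1)[OF g a] .
      \<comment> \<open>On the image of \<open>g\<close> the projection must change nothing. There
        \<open>\<psi>\<close> comes from a map on \<open>M/N\<close>, so its values already lie in
        the annihilator.\<close>
      have "\<psi> (g a) y = \<one>\<^bsub>rat_mod_int\<^esub>" if y: "y \<in> N" for y
      proof -
        have "N +>\<^bsub>M\<^esub> y = \<zero>\<^bsub>?Q\<^esub>"
          using y M.a_coset_join2[OF Nc[OF y] N.subgroup_axioms y] by (simp add: quotient_module_def)
        then have "\<psi> (g a) y = \<beta> \<zero>\<^bsub>?Q\<^esub> a" using \<gamma>\<beta> a Nc[OF y] by (simp add: \<psi>_def)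
        also have "\<dots> = \<one>\<^bsub>rat_mod_int\<^esub>"
          \<comment> \<open>Additivity at zero plus zero makes this value idempotent in
            \<open>Q/Z\<close>, hence trivial.\<close>
          using \<beta>(1)[of "\<zero>\<^bsub>?Q\<^esub>" a] \<beta>(2)[of "\<zero>\<^bsub>?Q\<^esub>" "\<zero>\<^bsub>?Q\<^esub>" a] a by simp
        finally show ?thesis .
      qed
      then have "\<pi> (\<psi> (g a)) = \<psi> (g a)" using \<psi>[OF ga] by (intro \<pi>_id) (simp add: annihilator_def)
      then show ?thesis using x ga a by (simp add: \<beta>' \<psi>_def \<gamma>\<beta>)
    qed
    ultimately show "\<exists>\<beta>'. balanced_map R ?Q B \<beta>' \<and>
      (\<forall>C \<in> carrier ?Q. \<forall>a \<in> carrier A. \<beta>' C (g a) = \<beta> C a)" by blast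
  qed
qed

theorem theorem4p2:
  fixes R :: "('r, 'k) ring_scheme" and M :: "('r, 'a, 'm) module_scheme"
  assumes "ring R"
    and "right_module R M"
    and "carrier M \<noteq> {\<zero>\<^bsub>M\<^esub>}"
    and "Baer_module R (character_module M)"
  shows "(\<forall>Y. submodule Y R M \<longrightarrow>
            pure_submodule TYPE('u) R M (module_trace R M (M\<lparr>carrier := Y\<rparr>))) \<and>
         (flat_module TYPE('u) R M \<longrightarrow>
            (\<forall>N. submodule N R M \<and> Gen TYPE('i) R M (M\<lparr>carrier := N\<rparr>) \<longrightarrow>
              flat_module TYPE('u) R (quotient_module R M N)))"
proof (intro conjI allI impI)
  note M = assms(2) and Baer = assms(4)
  show "pure_submodule TYPE('u) R M (module_trace R M (M\<lparr>carrier := Y\<rparr>))"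
    if Y: "submodule Y R M" for Y
    by (rule pure_submodule_if_annihilator_summand[OF M submodule_module_trace[OF M Y]
          Baer_annihilator_trace_summand[OF M Y Baer]])
  fix N assume flat: "flat_module TYPE('u) R M"
    and "submodule N R M \<and> Gen TYPE('i) R M (M\<lparr>carrier := N\<rparr>)"
  then have N: "submodule N R M" and gen: "Gen TYPE('i) R M (M\<lparr>carrier := N\<rparr>)" by auto
  show "flat_module TYPE('u) R (quotient_module R M N)"
    using Baer_annihilator_trace_summand[OF M N Baer]
    unfolding module_trace_eq_if_Gen[OF M N gen]
    by (rule flat_quotient_if_annihilator_summand[OF flat N])
qed

end
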